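(* Let $(M,\mu)$ and $(N,\nu)$ be measure spaces with finite measures and let $k:N\times M\to[-\infty,\infty]$ be $\nu\times\mu$-measurable. Suppose there are constants $A>0$, $B>0$, $\beta>1$, $\gamma>1$ and $0<\beta_0\le\beta$ such that, as $s\to+\infty$, $$m(k_1^*,s)\le A s^{-\beta}\big(1+O(\log^{-\gamma}s)\big),\qquad m(k_2^*,s)\le B s^{-\beta_0}.$$ Let $\beta'$ be defined by $\frac1\beta+\frac1{\beta'}=1$. Then the operator $Tf(x)=\int_M k(x,y)f(y)\,d\mu(y)$, $x\in N$, is defined on $L^{\beta'}(M)$, and there exists a constant $C$ such that $$\int_N \exp\bigg[\frac{\beta_0}{A\beta}\bigg(\frac{|Tf|}{\|f\|_{\beta'}}\bigg)^{\beta}\bigg]\,d\nu\le C$$ for each $f\in L^{\beta'}(M)$ (with $f\neq 0$).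
   Context: For a measurable $f$ on a measure space $(M,\mu)$: $m(f,s)=\mu(\{x\in M:|f(x)|>s\})$ for $s\ge0$ (distribution function); $f^*(t)=\inf\{s\ge0: m(f,s)\le t\}$ for $t>0$ (nonincreasing rearrangement). For functions on $(0,\infty)$ such as $k_1^*$, the distribution function $m(\cdot,s)$ is taken with respect to Lebesgue measure. For $k:N\times M\to[-\infty,\infty]$, $k^*(x,\cdot)$ denotes the rearrangement (w.r.t. $\mu$) of $y\mapsto k(x,y)$ for fixed $x$, and $k^*(\cdot,y)$ the rearrangement (w.r.t. $\nu$) of $x\mapsto k(x,y)$ for fixed $y$; then $k_1^*(t)=\sup_{x\in N}k^*(x,\cdot)(t)$ and $k_2^*(t)=\sup_{y\in M}k^*(\cdot,y)(t)$. $\|f\|_p=(\int|f|^p)^{1/p}$. The condition $m(k_1^*,s)\le As^{-\beta}(1+O(\log^{-\gamma}s))$ as $s\to\infty$ means there are $C_0,s_0$ with $m(k_1^*,s)\le As^{-\beta}(1+C_0(\log s)^{-\gamma})$ for all $s\ge s_0$. *)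

theory Defs
  imports "HOL-Analysis.Analysis"
begin

definition distrib_fun :: "'a measure \<Rightarrow> ('a \<Rightarrow> ereal) \<Rightarrow> real \<Rightarrow> ennreal" where
  "distrib_fun M f s = emeasure M {x \<in> space M. ereal s < \<bar>f x\<bar>}"

text \<open>Nonincreasing rearrangement f^*(t) = inf{s \<ge> 0 : m(f,s) \<le> t}, t > 0
  (value +infinity if the set is empty).\<close>
definition rearr :: "'a measure \<Rightarrow> ('a \<Rightarrow> ereal) \<Rightarrow> real \<Rightarrow> ereal" where
  "rearr M f t = Inf {ereal s | s. 0 \<le> s \<and> distrib_fun M f s \<le> ennreal t}"

definition kstar1 :: "'n measure \<Rightarrow> 'm measure \<Rightarrow> ('n \<Rightarrow> 'm \<Rightarrow> ereal) \<Rightarrow> real \<Rightarrow> ereal" where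
  "kstar1 N M k t = (SUP x \<in> space N. rearr M (k x) t)"

definition kstar2 :: "'n measure \<Rightarrow> 'm measure \<Rightarrow> ('n \<Rightarrow> 'm \<Rightarrow> ereal) \<Rightarrow> real \<Rightarrow> ereal" where
  "kstar2 N M k t = (SUP y \<in> space M. rearr N (\<lambda>x. k x y) t)"

definition lebesgue_pos :: "real measure" where
  "lebesgue_pos = restrict_space lborel {0<..}"

definition in_Lp :: "'a measure \<Rightarrow> real \<Rightarrow> ('a \<Rightarrow> real) \<Rightarrow> bool" where
  "in_Lp M p f \<longleftrightarrow> f \<in> borel_measurable M \<and> (\<integral>\<^sup>+ y. ennreal (\<bar>f y\<bar> powr p) \<partial>M) < \<infinity>"

definition Lp_norm :: "'a measure \<Rightarrow> real \<Rightarrow> ('a \<Rightarrow> real) \<Rightarrow> real" where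
  "Lp_norm M p f = (\<integral>y. \<bar>f y\<bar> powr p \<partial>M) powr (1 / p)"

text \<open>The integral operator Tf(x) = \<integral> k(x,y) f(y) d mu(y) (meaningful where the integrand is integrable).\<close>
definition intop :: "'m measure \<Rightarrow> ('n \<Rightarrow> 'm \<Rightarrow> ereal) \<Rightarrow> ('m \<Rightarrow> real) \<Rightarrow> 'n \<Rightarrow> real" where
  "intop M k f x = (\<integral>y. real_of_ereal (k x y) * f y \<partial>M)"

end

theory Submission
  imports Defs
begin

text \<open>
  Normalise \<open>f \<ge> 0\<close> to have norm 1 and let \<open>p = \<beta>'\<close>. The hypotheses say that every section of \<open>\<kappa> = \<bar>k\<bar>\<close> has
  distribution function at most \<open>A s\<^bsup>-\<beta>\<^esup>(1 + C log\<^bsup>-\<gamma>\<^esup> s)\<close> in one variable and \<open>B s\<^bsup>-\<beta>0\<^esup>\<close> in the other.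
  For each level \<open>n\<close> choose a height \<open>h\<close> with
  \<open>h\<^bsup>p\<^esup> e\<^bsup>-\<beta>n\<^esup> = \<integral> max (f\<^bsup>p\<^esup> - h\<^bsup>p\<^esup>) 0 =: \<epsilon>\<close>, and cut \<open>f\<close> at \<open>h\<close> and \<open>\<kappa>\<close> at \<open>e\<^bsup>n\<^esup>\<close>. Small \<open>\<kappa>\<close> against
  \<open>min f h\<close> is handled by Hoelder with the sharp constant \<open>A \<beta> n + O(1)\<close> (bounded because \<open>\<gamma> > 1\<close>),
  the mixed pieces are \<open>O(\<epsilon>\<^bsup>1/p\<^esup>)\<close> by the choice of \<open>h\<close>, and large \<open>\<kappa>\<close> against \<open>max (f - h) 0\<close> is at most
  \<open>\<epsilon>\<^bsup>1/p\<^esup>\<close> outside a set of measure \<open>O(e\<^bsup>-\<beta>0 n\<^esup>)\<close>. Comparing two levels \<open>i \<le> n\<close> gives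
  \<open>(Tf)\<^bsup>\<beta>\<^esup>/(A \<beta>) \<le> Y n\<close> off that exceptional set, and the Adams-Garsia counting argument shows that
  \<open>n - Y n \<le> l\<close> holds for only \<open>O(l + 1)\<close> values of \<open>n\<close>; hence \<open>\<Sum> e\<^bsup>-\<beta>0(n - Y n)\<^esup>\<close> is bounded
  independently of \<open>f\<close>.
\<close>

subsection \<open>Real inequalities and the exponential sum\<close>

lemma Youngs_inequality_powr:
  fixes a b :: real
  assumes "0 < \<alpha>" "0 < \<beta>" "\<alpha> + \<beta> = 1" "0 \<le> a" "0 \<le> b"
  shows "a powr \<alpha> * b powr \<beta> \<le> \<alpha> * a + \<beta> * b"
  using assms Youngs_inequality_0[of \<alpha> \<beta> a b] by (cases "a = 0 \<or> b = 0") auto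

text \<open>Young's inequality after dividing by the sums \<open>a + c\<close> and
  \<open>b + d\<close>. It later merges the two summands of a level bound into one product, whose
  \<open>\<beta>\<close>-th power is explicit because
  \<open>\<beta> / p = \<beta> - 1\<close>.\<close>

lemma Holder_inequality_two:
  fixes a b c d :: real
  assumes pq: "0 < \<alpha>" "0 < \<beta>" "\<alpha> + \<beta> = 1" and nn: "0 \<le> a" "0 \<le> b" "0 \<le> c" "0 \<le> d"
  shows "a powr \<alpha> * b powr \<beta> + c powr \<alpha> * d powr \<beta> \<le> (a + c) powr \<alpha> * (b + d) powr \<beta>"
proof (cases "a + c = 0 \<or> b + d = 0")
  case True
  then have "a = 0 \<and> c = 0 \<or> b = 0 \<and> d = 0" using nn by linarith
  then show ?thesis by auto
next
  case False
  define S where "S = a + c"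
  define T where "T = b + d"
  have ST: "S > 0" "T > 0" using False nn by (auto simp: S_def T_def)
  have "(a / S) powr \<alpha> * (b / T) powr \<beta> + (c / S) powr \<alpha> * (d / T) powr \<beta>
      \<le> (\<alpha> * (a / S) + \<beta> * (b / T)) + (\<alpha> * (c / S) + \<beta> * (d / T))"
    by (intro add_mono Youngs_inequality_powr pq) (use nn ST in auto)
  also have "\<dots> = \<alpha> * ((a + c) / S) + \<beta> * ((b + d) / T)"
    by (simp add: algebra_simps add_divide_distrib)
  also have "\<dots> = 1" using ST pq by (simp add: S_def T_def)
  finally have "(a powr \<alpha> * b powr \<beta> + c powr \<alpha> * d powr \<beta>) / (S powr \<alpha> * T powr \<beta>) \<le> 1"
    by (simp add: powr_divide add_divide_distrib)
  then show ?thesis using ST by (simp add: S_def T_def)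
qed

text \<open>For \<open>r \<ge> 1\<close> a power of a number in the unit interval is at most the
  number itself; for \<open>r < 1\<close> the bound is concavity, in the form of Young's inequality
  against \<open>1\<close>. Both cases occur, since the exponent will be
  \<open>\<beta> - 1\<close>.\<close>

lemma powr_one_minus_le:
  fixes t r :: real
  assumes "0 \<le> t" "t \<le> 1" "0 < r"
  shows "(1 - t) powr r \<le> 1 - min r 1 * t"
proof (cases "r \<ge> 1")
  case True
  have "(1 - t) powr r \<le> (1 - t) powr 1"
    using assms True by (intro powr_mono') auto
  then show ?thesis using True assms by simp
next
  case False
  have "(1 - t) powr r * 1 powr (1 - r) \<le> r * (1 - t) + (1 - r) * 1"
    by (intro Youngs_inequality_powr) (use assms False in auto)
  then show ?thesis using False by (simp add: algebra_simps)
qed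

text \<open>Passes through \<open>exp (r * t)\<close>: multiplying
  \<open>1 - z \<le> exp (- z)\<close> by \<open>exp z\<close> gives
  \<open>exp z \<le> 1 + z * exp z\<close>. The cap \<open>t \<le> D\<close> turns the slope into a
  constant.\<close>

lemma powr_one_plus_le:
  fixes t r D :: real
  assumes "0 \<le> t" "t \<le> D" "0 < r"
  shows "(1 + t) powr r \<le> 1 + r * exp (r * D) * t"
proof -
  have "(1 + t) powr r \<le> exp (r * t)"
    using assms ln_add_one_self_le_self[of t] by (simp add: powr_def)
  also have "\<dots> \<le> 1 + r * t * exp (r * t)"
  proof -
    have "1 - r * t \<le> exp (- (r * t))" using exp_ge_add_one_self[of "- (r * t)"] by simp
    then have "(1 - r * t) * exp (r * t) \<le> exp (- (r * t)) * exp (r * t)"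
      by (intro mult_right_mono) auto
    then show ?thesis by (simp add: algebra_simps flip: exp_add)
  qed
  also have "\<dots> \<le> 1 + r * t * exp (r * D)"
    using assms by (intro add_left_mono mult_left_mono) auto
  finally show ?thesis by (simp add: algebra_simps)
qed

text \<open>The indices are grouped by the rounded-up value of \<open>\<Phi>\<close>: group
  \<open>l\<close> has at most \<open>K * (l + 1)\<close> members, each contributing at most a
  multiple of \<open>exp (- \<theta> * l)\<close>, and such a series converges. \<open>C\<close> is
  obtained before \<open>\<Phi>\<close> and \<open>n\<close>, so it is uniform in both.\<close>

lemma sum_exp_le_of_linear_count:
  fixes \<theta> a K :: real
  assumes "0 < \<theta>" "0 \<le> K"
  obtains C where "0 \<le> C"
    "\<And>\<Phi> n. \<lbrakk>\<And>i::nat. - a \<le> \<Phi> i; \<And>l. 0 \<le> l \<Longrightarrow> finite {i. \<Phi> i \<le> l} \<and> real (card {i. \<Phi> i \<le> l}) \<le> K * (l + 1)\<rbrakk>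
      \<Longrightarrow> (\<Sum>i<n. exp (- \<theta> * \<Phi> i)) \<le> C"
proof -
  \<comment> \<open>\<open>c\<close> pays for the rounding and for negative values, which
    \<open>nat\<close> sends to group \<open>0\<close>: \<open>real (j i)\<close> exceeds
    \<open>\<Phi> i\<close> by at most \<open>\<bar>a\<bar> + 1\<close>.\<close>
  define c where "c = exp (\<theta> * (\<bar>a\<bar> + 1))"
  define g where "g = (\<lambda>j::nat. c * exp (- \<theta> * real j) * (K * (real j + 1)))"
  have z: "exp (- \<theta> * real j) = exp (- \<theta>) ^ j" for j
    by (simp add: exp_of_nat_mult[symmetric] mult.commute)
  have zn: "norm (exp (- \<theta>)) < 1" using assms by simp
  have s1: "summable (\<lambda>j. real j * exp (- \<theta>) ^ j)"
  proof -
    have "summable (\<lambda>n. of_nat (Suc n) * exp (- \<theta>) ^ n)"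
      using zn by (intro sums_summable[OF geometric_deriv_sums]) 
    moreover have "summable (\<lambda>n. exp (- \<theta>) ^ n)" using zn by (rule summable_geometric)
    ultimately have "summable (\<lambda>n. of_nat (Suc n) * exp (- \<theta>) ^ n - exp (- \<theta>) ^ n)" by (rule summable_diff)
    then show ?thesis by (simp add: algebra_simps)
  qed
  have "summable (\<lambda>j. c * K * (real j * exp (- \<theta>) ^ j + exp (- \<theta>) ^ j))"
    using s1 zn by (intro summable_mult summable_add summable_geometric)
  then have sg: "summable g" unfolding g_def z by (simp add: algebra_simps)
  have g0: "g j \<ge> 0" for j using assms by (auto simp: g_def c_def)
  show ?thesis
  proof (rule that)
    show "0 \<le> suminf g" using sg g0 by (rule suminf_nonneg)
    fix \<Phi> :: "nat \<Rightarrow> real" and n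
    assume lower: "\<And>i. - a \<le> \<Phi> i"
      and cnt: "\<And>l. 0 \<le> l \<Longrightarrow> finite {i. \<Phi> i \<le> l} \<and> real (card {i. \<Phi> i \<le> l}) \<le> K * (l + 1)"
    define j where "j = (\<lambda>i. nat \<lceil>\<Phi> i\<rceil>)"
    have j1: "\<Phi> i \<le> real (j i)" for i unfolding j_def by linarith
    have j2: "real (j i) \<le> \<Phi> i + \<bar>a\<bar> + 1" for i unfolding j_def using lower[of i] by linarith
    define J where "J = Suc (Max (insert 0 (j ` {..<n})))"
    have jJ: "j i < J" if "i < n" for i
      unfolding J_def less_Suc_eq_le using that by (intro Max_ge) auto
    \<comment> \<open>Each term is written as a sum over its single group, so that interchanging the
      sums counts group by group.\<close>
    have "(\<Sum>i<n. exp (- \<theta> * \<Phi> i)) \<le> (\<Sum>i<n. \<Sum>l<J. if l = j i then c * exp (- \<theta> * real l) else 0)"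
    proof (intro sum_mono)
      fix i assume "i \<in> {..<n}"
      have "- \<theta> * \<Phi> i \<le> \<theta> * (\<bar>a\<bar> + 1) + (- \<theta> * real (j i))"
        using mult_left_mono[OF j2[of i], of \<theta>] assms by (simp add: algebra_simps)
      then have "exp (- \<theta> * \<Phi> i) \<le> c * exp (- \<theta> * real (j i))"
        unfolding c_def by (simp flip: exp_add)
      then show "exp (- \<theta> * \<Phi> i) \<le> (\<Sum>l<J. if l = j i then c * exp (- \<theta> * real l) else 0)"
        using jJ \<open>i \<in> _\<close> by simp
    qed
    also have "\<dots> = (\<Sum>l<J. \<Sum>i<n. if l = j i then c * exp (- \<theta> * real l) else 0)"
      by (rule sum.swap)
    also have "\<dots> \<le> (\<Sum>l<J. g l)"
    proof (intro sum_mono)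
      fix l
      have f: "finite {i. \<Phi> i \<le> real l}" "real (card {i. \<Phi> i \<le> real l}) \<le> K * (real l + 1)"
        using cnt[of "real l"] by auto
      have "(\<Sum>i<n. if l = j i then c * exp (- \<theta> * real l) else 0)
          = (\<Sum>i\<in>{i\<in>{..<n}. l = j i}. c * exp (- \<theta> * real l))"
        by (rule sum.inter_filter[symmetric]) simp
      also have "\<dots> = real (card {i\<in>{..<n}. l = j i}) * (c * exp (- \<theta> * real l))" by (rule sum_constant)
      also have "real (card {i\<in>{..<n}. l = j i}) \<le> real (card {i. \<Phi> i \<le> real l})"
        using j1 by (intro of_nat_mono card_mono f(1)) auto
      also have "\<dots> \<le> K * (real l + 1)" by (rule f(2))
      finally show "(\<Sum>i<n. if l = j i then c * exp (- \<theta> * real l) else 0) \<le> g l"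
        by (simp add: g_def c_def mult_ac mult_left_mono)
    qed
    also have "\<dots> \<le> suminf g" using sg g0 by (intro sum_le_suminf) auto
    finally show "(\<Sum>i<n. exp (- \<theta> * \<Phi> i)) \<le> suminf g" .
  qed
qed


text \<open>Put \<open>\<Phi> i = i - Y i\<close>. The choice \<open>m = 0\<close> yields
  \<open>\<Phi> i \<ge> \<kappa> * i * q i - c1\<close>, so a small \<open>\<Phi> i\<close> forces
  \<open>i * q i\<close> to be small. Inserting that \<open>q i\<close> into the bound for
  \<open>i + m\<close> makes \<open>\<Phi> (i + m)\<close> grow linearly in \<open>m\<close>. Hence
  the indices with \<open>\<Phi> \<le> l\<close> lie in an initial segment and one window, both of
  length \<open>O(l + 1)\<close>.\<close>

lemma Garsia_exponential_sum:
  fixes \<beta> p c D \<theta> :: real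
  assumes b: "1 < \<beta>" and p: "1 / \<beta> + 1 / p = 1" and nn: "0 \<le> c" "0 \<le> D" "0 < \<theta>"
  obtains C where "0 \<le> C"
    "\<And>q Y n. \<lbrakk>\<And>i::nat. 0 \<le> q i \<and> q i \<le> 1;
       \<And>i m. Y (i + m) \<le> ((real i + c) powr (1 / \<beta>) * (1 - q i) powr (1 / p)
                 + D * (real m + 1) powr (1 / \<beta>) * q i powr (1 / p)) powr \<beta>\<rbrakk>
      \<Longrightarrow> (\<Sum>i<n. exp (- \<theta> * (real i - Y i))) \<le> C"
proof -
  have p': "1 / p = 1 - 1 / \<beta>" using p by simp
  have p1: "0 < 1 / p" unfolding p' using b by simp
  have bp: "1 / p * \<beta> = \<beta> - 1" unfolding p' using b by (simp add: field_simps)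
  have b0: "0 < 1 / \<beta>" "1 / \<beta> * \<beta> = 1" using b by auto
  define c1 where "c1 = c + (D * 2 powr (1 / p)) powr \<beta>"
  define \<kappa> where "\<kappa> = min (\<beta> - 1) 1 / 2"
  define D2 where "D2 = (D * 2 powr (1 / \<beta>)) powr p"
  define E where "E = (\<beta> - 1) * exp ((\<beta> - 1) * D2) * D2"
  define c2 where "c2 = (c + 1 / 2) * (1 + E)"
  define K where "K = 6 * E * ((1 + c1) / \<kappa>) + 4 * c2 + 7"
  have k0: "0 < \<kappa>" using b by (simp add: \<kappa>_def)
  have c10: "0 \<le> c1" using nn by (simp add: c1_def)
  have E0: "0 \<le> E" using b by (simp add: E_def D2_def)
  have c20: "0 \<le> c2" using nn E0 by (simp add: c2_def)
  have K0: "0 \<le> K" using E0 c10 k0 c20 by (simp add: K_def)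
  have p0: "p > 0" using p1 by (cases "p > 0") (auto simp: field_simps)
  obtain C where C: "0 \<le> C" "\<And>\<Phi> n. \<lbrakk>\<And>i::nat. - c1 \<le> \<Phi> i;
      \<And>l. 0 \<le> l \<Longrightarrow> finite {i. \<Phi> i \<le> l} \<and> real (card {i. \<Phi> i \<le> l}) \<le> K * (l + 1)\<rbrakk>
      \<Longrightarrow> (\<Sum>i<n. exp (- \<theta> * \<Phi> i)) \<le> C"
    using sum_exp_le_of_linear_count[OF nn(3) K0, of c1] by metis
  show ?thesis
  proof (rule that[OF C(1)])
    fix q Y :: "nat \<Rightarrow> real" and n
    assume q: "\<And>i::nat. 0 \<le> q i \<and> q i \<le> 1"
      and Y: "\<And>i m. Y (i + m) \<le> ((real i + c) powr (1 / \<beta>) * (1 - q i) powr (1 / p)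
                 + D * (real m + 1) powr (1 / \<beta>) * q i powr (1 / p)) powr \<beta>"
    define \<Phi> where "\<Phi> = (\<lambda>i. real i - Y i)"
    have A: "\<kappa> * (real i * q i) - c1 \<le> \<Phi> i" for i
    proof -
      \<comment> \<open>Only the weight \<open>q i / 2\<close> is assigned to the \<open>D\<close>
        term, whose constant goes into \<open>d\<close>. The weights then add up to
        \<open>1 - q i / 2\<close>, and the missing half is the gain in
        \<open>i * q i\<close>.\<close>
      define d where "d = (D * 2 powr (1 / p)) powr \<beta>"
      have q2: "0 \<le> 1 - q i" "0 \<le> q i / 2" "0 \<le> q i" "q i \<le> 1" using q[of i] by auto
      have "D * q i powr (1 / p) = (D * 2 powr (1 / p)) * (q i / 2) powr (1 / p)"
        by (simp add: powr_divide)
      also have "D * 2 powr (1 / p) = d powr (1 / \<beta>)"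
        using nn b by (simp add: d_def powr_powr)
      finally have *: "D * q i powr (1 / p) = d powr (1 / \<beta>) * (q i / 2) powr (1 / p)" .
      have "Y i \<le> ((real i + c) powr (1 / \<beta>) * (1 - q i) powr (1 / p) + d powr (1 / \<beta>) * (q i / 2) powr (1 / p)) powr \<beta>"
        using Y[of i 0] unfolding *[symmetric] by simp
      also have "\<dots> \<le> ((real i + c + d) powr (1 / \<beta>) * (1 - q i + q i / 2) powr (1 / p)) powr \<beta>"
        using b by (intro powr_mono2 Holder_inequality_two b0 p1 p add_nonneg_nonneg mult_nonneg_nonneg)
          (use q2 nn in \<open>auto simp: d_def\<close>)
      also have "\<dots> = (real i + c + d) * (1 - q i / 2) powr (\<beta> - 1)"
        using nn b bp by (simp add: powr_mult powr_powr d_def)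
      also have "\<dots> \<le> (real i + c + d) * (1 - min (\<beta> - 1) 1 * (q i / 2))"
        by (intro mult_left_mono powr_one_minus_le) (use q2 nn b in \<open>auto simp: d_def\<close>)
      also have "\<dots> = (real i + c1) * (1 - \<kappa> * q i)"
        by (simp add: c1_def d_def \<kappa>_def)
      also have "\<dots> \<le> real i + c1 - \<kappa> * (real i * q i)"
        using c10 k0 q2 by (simp add: algebra_simps)
      finally show ?thesis by (simp add: \<Phi>_def)
    qed
    have low: "- c1 \<le> \<Phi> i" for i
    proof -
      have "0 \<le> \<kappa> * (real i * q i)" using k0 q[of i] by simp
      with A[of i] show ?thesis by linarith
    qed
    have B: "real m / 2 - (E * (real i * q i) + E * q i * real m / 2 + c2) \<le> \<Phi> (i + m)" for i m
    proof -
      have q2: "0 \<le> 1 - q i" "0 \<le> q i" "q i \<le> 1" using q[of i] by auto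
      \<comment> \<open>The weight is now shifted the other way: only about half of \<open>m\<close>
        is charged, as \<open>s\<close>, and \<open>q i\<close> carries the constant
        \<open>D2\<close> instead. The other half of \<open>m\<close> survives as the linear growth
        of \<open>\<Phi> (i + m)\<close>.\<close>
      define s where "s = (real m + 1) / 2"
      have "D * (real m + 1) powr (1 / \<beta>) * q i powr (1 / p)
          = s powr (1 / \<beta>) * ((D * 2 powr (1 / \<beta>)) * q i powr (1 / p))"
        by (simp add: s_def powr_divide)
      also have "(D * 2 powr (1 / \<beta>)) = D2 powr (1 / p)"
        using nn p0 by (simp add: D2_def powr_powr)
      finally have *: "D * (real m + 1) powr (1 / \<beta>) * q i powr (1 / p)
          = s powr (1 / \<beta>) * (D2 * q i) powr (1 / p)" by (simp add: powr_mult)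
      have "Y (i + m) \<le> ((real i + c) powr (1 / \<beta>) * (1 - q i) powr (1 / p) + s powr (1 / \<beta>) * (D2 * q i) powr (1 / p)) powr \<beta>"
        using Y[of i m] unfolding * .
      also have "\<dots> \<le> ((real i + c + s) powr (1 / \<beta>) * (1 - q i + D2 * q i) powr (1 / p)) powr \<beta>"
        using b by (intro powr_mono2 Holder_inequality_two b0 p1 p add_nonneg_nonneg mult_nonneg_nonneg)
          (use q2 nn in \<open>auto simp: s_def D2_def\<close>)
      also have "\<dots> = (real i + c + s) * (1 - q i + D2 * q i) powr (\<beta> - 1)"
        using nn b bp by (simp add: powr_mult powr_powr s_def)
      also have "\<dots> \<le> (real i + c + s) * (1 + D2 * q i) powr (\<beta> - 1)"
        by (intro mult_left_mono powr_mono2) (use q2 nn b in \<open>auto simp: s_def D2_def\<close>)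
      also have "\<dots> \<le> (real i + c + s) * (1 + (\<beta> - 1) * exp ((\<beta> - 1) * D2) * (D2 * q i))"
        by (intro mult_left_mono powr_one_plus_le)
          (use q2 nn b in \<open>auto simp: s_def D2_def intro: mult_left_le\<close>)
      also have "\<dots> = (real i + c + s) * (1 + E * q i)" by (simp add: E_def)
      also have "\<dots> = real i + real m / 2 + (E * (real i * q i) + E * q i * real m / 2) + (c + 1 / 2) * (1 + E * q i)"
        by (simp add: s_def field_simps)
      also have "\<dots> \<le> real i + real m / 2 + (E * (real i * q i) + E * q i * real m / 2) + c2"
        unfolding c2_def using nn E0 q2 
        by (intro add_left_mono mult_left_mono) (auto intro: mult_left_le)
      finally show ?thesis by (simp add: \<Phi>_def)
    qed
    have cnt: "finite {i. \<Phi> i \<le> l} \<and> real (card {i. \<Phi> i \<le> l}) \<le> K * (l + 1)" if l: "0 \<le> l" for l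
    proof -
      \<comment> \<open>\<open>L\<close> bounds \<open>i * q i\<close> on the counted set, from
        \<open>N\<close> on the counted indices satisfy \<open>2 * E * q i \<le> 1\<close>, and
        \<open>W\<close> is the length of the window. The \<open>+ 1\<close> in \<open>N\<close>
        makes these indices positive, so that \<open>i0\<close> can be cancelled.\<close>
      define L where "L = (l + c1) / \<kappa>"
      define N where "N = nat \<lceil>2 * E * L\<rceil> + 1"
      define W where "W = nat \<lfloor>4 * (l + c2 + E * L)\<rfloor>"
      have L0: "0 \<le> L" using l c10 k0 by (simp add: L_def)
      have iq: "real i * q i \<le> L" if "\<Phi> i \<le> l" for i
        using A[of i] that k0 by (simp add: L_def pos_le_divide_eq mult.commute)
      have "\<exists>i0. {i. \<Phi> i \<le> l} \<subseteq> {..<N} \<union> {i0..i0 + W}"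
      proof (cases "\<exists>i\<ge>N. \<Phi> i \<le> l")
        case False
        then have "{i. \<Phi> i \<le> l} \<subseteq> {..<N}" by (auto simp: not_le[symmetric])
        then show ?thesis by blast
      next
        case True
        define i0 where "i0 = (LEAST i. N \<le> i \<and> \<Phi> i \<le> l)"
        have i0: "N \<le> i0" "\<Phi> i0 \<le> l" using LeastI_ex[of "\<lambda>i. N \<le> i \<and> \<Phi> i \<le> l"] True by (auto simp: i0_def)
        have i0N: "2 * E * L \<le> real i0" "0 < real i0" using i0(1) unfolding N_def by linarith+
        have rearrange: "x \<le> 4 * (l + c2 + z)" if "x / 4 - (z + c2) \<le> l" for x z
          using that by argo
        have up: "j \<le> i0 + W" if j: "N \<le> j" "\<Phi> j \<le> l" for j
        proof -
          have "i0 \<le> j" unfolding i0_def using j by (intro Least_le) auto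
          then obtain m where m: "j = i0 + m" using le_Suc_ex by blast
          \<comment> \<open>Since \<open>i0 \<ge> 2 * E * L\<close> and
            \<open>i0 * q i0 \<le> L\<close>, the loss proportional to \<open>q i0 * m\<close> is at
            most \<open>m / 4\<close>, which leaves \<open>m / 4\<close> of the growth
            \<open>m / 2\<close>.\<close>
          have "2 * E * (real i0 * q i0) \<le> real i0"
            using mult_left_mono[OF iq[OF i0(2)], of "2 * E"] E0 i0N(1) by linarith
          then have "real i0 * (2 * E * q i0) \<le> real i0 * 1" by (simp add: algebra_simps)
          then have "2 * E * q i0 \<le> 1" using i0N(2) by simp
          then have "E * q i0 * real m / 2 \<le> real m / 4"
            using mult_right_mono[of "2 * E * q i0" 1 "real m"] by (simp add: mult_ac)
          moreover have "E * (real i0 * q i0) \<le> E * L"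
            using iq[OF i0(2)] E0 by (intro mult_left_mono)
          ultimately have "real m / 4 - (E * L + c2) \<le> l"
            using B[of m i0] j(2) unfolding m by linarith
          then have "real m \<le> 4 * (l + c2 + E * L)" by (rule rearrange)
          then have "m \<le> W" unfolding W_def by (rule le_nat_floor)
          then show ?thesis by (simp add: m)
        qed
        have lo: "i0 \<le> j" if "N \<le> j" "\<Phi> j \<le> l" for j
          unfolding i0_def using that by (intro Least_le) auto
        have "{i. \<Phi> i \<le> l} \<subseteq> {..<N} \<union> {i0..i0 + W}"
        proof
          fix j assume "j \<in> {i. \<Phi> i \<le> l}"
          then show "j \<in> {..<N} \<union> {i0..i0 + W}"
            using up[of j] lo[of j] by (cases "j < N") (simp_all add: not_less)
        qed
        then show ?thesis by blast
      qed
      then obtain i0 where sub: "{i. \<Phi> i \<le> l} \<subseteq> {..<N} \<union> {i0..i0 + W}" by blast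
      have "card {i. \<Phi> i \<le> l} \<le> card ({..<N} \<union> {i0..i0 + W})"
        by (intro card_mono sub) auto
      also have "\<dots> \<le> N + (W + 1)" by (rule order_trans[OF card_Un_le]) simp
      finally have "real (card {i. \<Phi> i \<le> l}) \<le> real N + real W + 1" by linarith
      also have "\<dots> \<le> (2 * E * L + 2) + (4 * (l + c2 + E * L)) + 1"
      proof -
        have "0 \<le> 2 * E * L" "0 \<le> 4 * (l + c2 + E * L)" using E0 L0 l c20 by auto
        then show ?thesis unfolding N_def W_def by linarith
      qed
      also have "\<dots> = 6 * E * L + 4 * c2 + 4 * l + 3" by (simp add: algebra_simps)
      also have "\<dots> \<le> 6 * E * ((1 + c1) / \<kappa> * (l + 1)) + 4 * c2 * (l + 1) + 7 * (l + 1)"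
      proof -
        have "l + c1 \<le> (1 + c1) * (l + 1)" using l c10 by (simp add: algebra_simps)
        then have "L \<le> (1 + c1) / \<kappa> * (l + 1)" unfolding L_def using k0 by (simp add: divide_right_mono)
        then have "6 * E * L \<le> 6 * E * ((1 + c1) / \<kappa> * (l + 1))" using E0 by (intro mult_left_mono) auto
        moreover have "4 * c2 \<le> 4 * c2 * (l + 1)" using c20 l by (simp add: algebra_simps)
        ultimately show ?thesis using l by simp
      qed
      also have "\<dots> = K * (l + 1)" by (simp add: K_def algebra_simps)
      finally show ?thesis using finite_subset[OF sub] by simp
    qed
    have "(\<Sum>i<n. exp (- \<theta> * \<Phi> i)) \<le> C" by (rule C(2)[OF low cnt])
    then show "(\<Sum>i<n. exp (- \<theta> * (real i - Y i))) \<le> C" by (simp add: \<Phi>_def)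
  qed
qed

subsection \<open>Hoelder inequality and layer cake\<close>

text \<open>Stated for upper bounds \<open>a\<close>, \<open>b\<close> of the integrals, so that
  estimates can be inserted directly. Young's inequality is applied to
  \<open>u / a powr (1 / p)\<close> and \<open>v / b powr (1 / q)\<close>; this normalisation
  excludes \<open>a = 0\<close> and \<open>b = 0\<close>, where one factor vanishes almost
  everywhere.\<close>

lemma nn_integral_Holder_inequality:
  fixes u v :: "'a \<Rightarrow> real" and p q a b :: real
  assumes [measurable]: "u \<in> borel_measurable M" "v \<in> borel_measurable M"
    and nn: "\<And>x. x \<in> space M \<Longrightarrow> 0 \<le> u x" "\<And>x. x \<in> space M \<Longrightarrow> 0 \<le> v x" "0 \<le> a" "0 \<le> b"
    and pq: "1 < p" "1 < q" "1 / p + 1 / q = 1"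
    and I: "(\<integral>\<^sup>+ x. ennreal (u x powr p) \<partial>M) \<le> ennreal a" "(\<integral>\<^sup>+ x. ennreal (v x powr q) \<partial>M) \<le> ennreal b"
  shows "(\<integral>\<^sup>+ x. ennreal (u x * v x) \<partial>M) \<le> ennreal (a powr (1 / p) * b powr (1 / q))"
proof -
  have zero: "(\<integral>\<^sup>+ x. ennreal (f x * g x) \<partial>M) = 0"
    if [measurable]: "f \<in> borel_measurable M" "g \<in> borel_measurable M"
      and I: "(\<integral>\<^sup>+ x. ennreal (f x powr r) \<partial>M) \<le> 0" for f g :: "'a \<Rightarrow> real" and r :: real
  proof -
    have "(\<integral>\<^sup>+ x. ennreal (f x powr r) \<partial>M) = 0" using I by simp
    then have "AE x in M. ennreal (f x powr r) = 0" by (subst (asm) nn_integral_0_iff_AE) auto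
    then have "AE x in M. ennreal (f x * g x) = 0"
      by eventually_elim (metis ennreal_eq_0_iff ennreal_0 mult_zero_left order_antisym powr_eq_0_iff powr_ge_zero)
    then show ?thesis by (subst nn_integral_0_iff_AE) auto
  qed
  show ?thesis
  proof (cases "a = 0 \<or> b = 0")
    case True
    have "(\<integral>\<^sup>+ x. ennreal (u x * v x) \<partial>M) = 0"
    proof (cases "a = 0")
      case True
      then show ?thesis using zero[of u v p] I by simp
    next
      case False
      then have "b = 0" using True by simp
      then show ?thesis using zero[of v u q] I by (simp add: mult.commute)
    qed
    then show ?thesis by simp
  next
    case False
    then have ab: "0 < a" "0 < b" using nn by auto
    define k where "k = a powr (1 / p) * b powr (1 / q)"
    have k: "k > 0" using ab by (simp add: k_def)
    have pt: "u x * v x \<le> k / (p * a) * u x powr p + k / (q * b) * v x powr q" if x: "x \<in> space M" for x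
    proof -
      have "(u x / a powr (1 / p)) * (v x / b powr (1 / q))
          \<le> (u x / a powr (1 / p)) powr p / p + (v x / b powr (1 / q)) powr q / q"
        by (intro Youngs_inequality pq) (use nn x ab in auto)
      also have "\<dots> = (u x powr p / a) / p + (v x powr q / b) / q"
        using ab pq by (simp add: powr_divide powr_powr)
      finally have "k * ((u x / a powr (1 / p)) * (v x / b powr (1 / q))) \<le> k * ((u x powr p / a) / p + (v x powr q / b) / q)"
        using k by (intro mult_left_mono) auto
      moreover have "k * ((u x / a powr (1 / p)) * (v x / b powr (1 / q))) = u x * v x"
        using ab by (simp add: k_def)
      ultimately show ?thesis by (simp add: algebra_simps)
    qed
    have "(\<integral>\<^sup>+ x. ennreal (u x * v x) \<partial>M)
        \<le> (\<integral>\<^sup>+ x. ennreal (k / (p * a)) * ennreal (u x powr p) + ennreal (k / (q * b)) * ennreal (v x powr q) \<partial>M)"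
    proof (rule nn_integral_mono)
      fix x assume x: "x \<in> space M"
      have "ennreal (u x * v x) \<le> ennreal (k / (p * a) * u x powr p + k / (q * b) * v x powr q)"
        using pt[OF x] by (rule ennreal_leI)
      also have "\<dots> = ennreal (k / (p * a)) * ennreal (u x powr p) + ennreal (k / (q * b)) * ennreal (v x powr q)"
        using k ab pq by (simp flip: ennreal_mult ennreal_plus)
      finally show "ennreal (u x * v x) \<le> \<dots>" .
    qed
    also have "\<dots> = ennreal (k / (p * a)) * (\<integral>\<^sup>+ x. ennreal (u x powr p) \<partial>M)
        + ennreal (k / (q * b)) * (\<integral>\<^sup>+ x. ennreal (v x powr q) \<partial>M)"
      by (simp add: nn_integral_add nn_integral_cmult)
    also have "\<dots> \<le> ennreal (k / (p * a)) * ennreal a + ennreal (k / (q * b)) * ennreal b"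
      by (intro add_mono mult_left_mono I) auto
    also have "\<dots> = ennreal (k / (p * a) * a + k / (q * b) * b)"
    proof -
      have "0 \<le> k / (p * a)" "0 \<le> k / (q * b)" using k ab pq by auto
      then show ?thesis using nn(3,4) by (metis ennreal_mult ennreal_plus mult_nonneg_nonneg)
    qed
    also have "k / (p * a) * a + k / (q * b) * b = k * (1 / p + 1 / q)"
      using ab pq by (simp add: field_simps)
    also have "\<dots> = k" using pq by simp
    finally show ?thesis by (simp add: k_def)
  qed
qed

section \<open>Integrals of powers from bounds on the distribution function\<close>

lemma nn_integral_layer_cake:
  fixes g :: "'a \<Rightarrow> real" and \<phi> :: "real \<Rightarrow> ennreal"
  assumes "sigma_finite_measure M" and [measurable]: "g \<in> borel_measurable M" "\<phi> \<in> borel_measurable borel"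
  shows "(\<integral>\<^sup>+ y. (\<integral>\<^sup>+ r. \<phi> r * indicator {..<g y} r \<partial>lborel) \<partial>M)
    = (\<integral>\<^sup>+ r. \<phi> r * emeasure M {y \<in> space M. r < g y} \<partial>lborel)"
proof -
  interpret M: sigma_finite_measure M by fact
  interpret pair_sigma_finite lborel M ..
  have "(\<integral>\<^sup>+ y. (\<integral>\<^sup>+ r. \<phi> r * indicator {..<g y} r \<partial>lborel) \<partial>M)
      = (\<integral>\<^sup>+ y. (\<integral>\<^sup>+ r. \<phi> r * (if r < g y then 1 else 0) \<partial>lborel) \<partial>M)"
    by (intro nn_integral_cong) (simp add: indicator_def)
  also have "\<dots> = (\<integral>\<^sup>+ r. (\<integral>\<^sup>+ y. \<phi> r * (if r < g y then 1 else 0) \<partial>M) \<partial>lborel)"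
    by (rule Fubini') measurable
  also have "\<dots> = (\<integral>\<^sup>+ r. \<phi> r * emeasure M {y \<in> space M. r < g y} \<partial>lborel)"
  proof (intro nn_integral_cong)
    fix r
    have "(\<integral>\<^sup>+ y. \<phi> r * (if r < g y then 1 else 0) \<partial>M)
        = (\<integral>\<^sup>+ y. \<phi> r * indicator {y \<in> space M. r < g y} y \<partial>M)"
      by (intro nn_integral_cong) (auto simp: indicator_def)
    then show "(\<integral>\<^sup>+ y. \<phi> r * (if r < g y then 1 else 0) \<partial>M) = \<phi> r * emeasure M {y \<in> space M. r < g y}"
      by (simp add: nn_integral_cmult_indicator)
  qed
  finally show ?thesis .
qed

text \<open>\<open>T\<close> confines the radii contributing to the layer cake integral when \<open>P\<close> cuts \<open>g\<close> off from above.\<close>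

lemma nn_integral_powr_band_le:
  fixes g :: "'a \<Rightarrow> real" and \<psi> :: "real \<Rightarrow> real"
  assumes M: "sigma_finite_measure M" and [measurable]: "g \<in> borel_measurable M" "\<psi> \<in> borel_measurable borel"
    and s: "0 < s" and a: "0 < a"
    and \<psi>: "\<And>r. s \<le> r \<Longrightarrow> emeasure M {y \<in> space M. r < g y} \<le> ennreal (\<psi> r)"
    and T: "T \<in> sets borel" "\<And>r y. \<lbrakk>y \<in> space M; s \<le> r; r < g y; P y\<rbrakk> \<Longrightarrow> r \<in> T"
    and [measurable]: "Measurable.pred M P" and P: "\<And>y. \<lbrakk>y \<in> space M; P y\<rbrakk> \<Longrightarrow> s < g y"
  shows "(\<integral>\<^sup>+ y. ennreal (g y powr a) * indicator {y. P y} y \<partial>M)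
    \<le> ennreal (s powr a) * ennreal (\<psi> s) + (\<integral>\<^sup>+ r. ennreal (a * r powr (a - 1)) * ennreal (\<psi> r) * indicator (T \<inter> {s..}) r \<partial>lborel)"
proof -
  note T(1)[measurable]
  define \<phi> where "\<phi> = (\<lambda>r. ennreal (a * r powr (a - 1)) * indicator (T \<inter> {s..}) r)"
  have [measurable]: "\<phi> \<in> borel_measurable borel" unfolding \<phi>_def by measurable
  have meas: "(\<lambda>y. \<integral>\<^sup>+ r. \<phi> r * indicator {..<g y} r \<partial>lborel) \<in> borel_measurable M"
  proof -
    have "(\<lambda>y. \<integral>\<^sup>+ r. \<phi> r * (if r < g y then 1 else 0) \<partial>lborel) \<in> borel_measurable M" by measurable
    then show ?thesis by (simp add: indicator_def lessThan_def)
  qed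
  have "(\<integral>\<^sup>+ y. ennreal (g y powr a) * indicator {y. P y} y \<partial>M)
      \<le> (\<integral>\<^sup>+ y. ennreal (s powr a) * indicator {y \<in> space M. s < g y} y + (\<integral>\<^sup>+ r. \<phi> r * indicator {..<g y} r \<partial>lborel) \<partial>M)"
  proof (rule nn_integral_mono)
    fix y assume y: "y \<in> space M"
    show "ennreal (g y powr a) * indicator {y. P y} y
      \<le> ennreal (s powr a) * indicator {y \<in> space M. s < g y} y + (\<integral>\<^sup>+ r. \<phi> r * indicator {..<g y} r \<partial>lborel)"
    proof (cases "P y")
      case True
      then have sg: "s < g y" using P y by auto
      have "(\<integral>\<^sup>+ r. ennreal (a * r powr (a - 1)) * indicator {s..g y} r \<partial>lborel) = g y powr a - s powr a"
        by (rule nn_integral_FTC_Icc)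
           (use s a sg in \<open>auto intro!: derivative_eq_intros simp: field_simps\<close>)
      moreover have "(\<integral>\<^sup>+ r. ennreal (a * r powr (a - 1)) * indicator {s..g y} r \<partial>lborel)
          = (\<integral>\<^sup>+ r. \<phi> r * indicator {..<g y} r \<partial>lborel)"
      proof (rule nn_integral_cong_AE)
        \<comment> \<open>The closed interval of the fundamental theorem and the open ray of the
          layer cake formula disagree only at \<open>r = g y\<close>.\<close>
        have "AE r in lborel. r \<noteq> g y" by (rule AE_lborel_singleton)
        then show "AE r in lborel. ennreal (a * r powr (a - 1)) * indicator {s..g y} r = \<phi> r * indicator {..<g y} r"
          by eventually_elim (use T(2)[OF y _ _ True] in \<open>auto simp: \<phi>_def indicator_def\<close>)
      qed
      ultimately have "(\<integral>\<^sup>+ r. \<phi> r * indicator {..<g y} r \<partial>lborel) = ennreal (g y powr a - s powr a)" by simp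
      moreover have "s powr a \<le> g y powr a" using s a sg by (intro powr_mono2) auto
      ultimately show ?thesis using True y sg by (simp flip: ennreal_plus)
    qed simp
  qed
  also have "\<dots> = ennreal (s powr a) * emeasure M {y \<in> space M. s < g y}
      + (\<integral>\<^sup>+ r. \<phi> r * emeasure M {y \<in> space M. r < g y} \<partial>lborel)"
    using meas by (simp add: nn_integral_add nn_integral_cmult_indicator nn_integral_layer_cake[OF M])
  also have "\<dots> \<le> ennreal (s powr a) * ennreal (\<psi> s) + (\<integral>\<^sup>+ r. \<phi> r * ennreal (\<psi> r) \<partial>lborel)"
  proof (rule add_mono)
    show "ennreal (s powr a) * emeasure M {y \<in> space M. s < g y} \<le> ennreal (s powr a) * ennreal (\<psi> s)"
      by (intro mult_left_mono \<psi>) auto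
  next
    show "(\<integral>\<^sup>+ r. \<phi> r * emeasure M {y \<in> space M. r < g y} \<partial>lborel) \<le> (\<integral>\<^sup>+ r. \<phi> r * ennreal (\<psi> r) \<partial>lborel)"
    proof (rule nn_integral_mono)
      fix r
      show "\<phi> r * emeasure M {y \<in> space M. r < g y} \<le> \<phi> r * ennreal (\<psi> r)"
        by (cases "s \<le> r") (auto simp: \<phi>_def intro: \<psi> mult_left_mono)
    qed
  qed
  finally show ?thesis by (simp add: \<phi>_def mult_ac)
qed

text \<open>The band estimate with \<open>T = UNIV\<close>. The radial integral converges at
  infinity because \<open>a < b\<close>; it contributes \<open>a / (b - a)\<close> and the boundary
  term \<open>1\<close>, together \<open>b / (b - a)\<close>.\<close>

lemma nn_integral_powr_tail_le:
  fixes g :: "'a \<Rightarrow> real"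
  assumes M: "sigma_finite_measure M" and [measurable]: "g \<in> borel_measurable M"
    and s: "0 < s" and a: "0 < a" "a < b" and K: "0 \<le> K"
    and tail: "\<And>r. 0 < r \<Longrightarrow> emeasure M {y \<in> space M. r < g y} \<le> ennreal (K * r powr (- b))"
  shows "(\<integral>\<^sup>+ y. ennreal (g y powr a) * indicator {y. s < g y} y \<partial>M)
    \<le> ennreal (K * (b / (b - a)) * s powr (a - b))"
proof -
  have "(\<integral>\<^sup>+ y. ennreal (g y powr a) * indicator {y. s < g y} y \<partial>M)
      \<le> ennreal (s powr a) * ennreal (K * s powr (- b))
        + (\<integral>\<^sup>+ r. ennreal (a * r powr (a - 1)) * ennreal (K * r powr (- b)) * indicator (UNIV \<inter> {s..}) r \<partial>lborel)"
    by (rule nn_integral_powr_band_le[OF M]) (use s a tail in auto)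
  also have "(\<integral>\<^sup>+ r. ennreal (a * r powr (a - 1)) * ennreal (K * r powr (- b)) * indicator (UNIV \<inter> {s..}) r \<partial>lborel)
      = (\<integral>\<^sup>+ r. ennreal (K * a * r powr (a - b - 1)) * indicator {s..} r \<partial>lborel)"
  proof (intro nn_integral_cong)
    fix r :: real
    show "ennreal (a * r powr (a - 1)) * ennreal (K * r powr (- b)) * indicator (UNIV \<inter> {s..}) r
      = ennreal (K * a * r powr (a - b - 1)) * indicator {s..} r"
    proof (cases "s \<le> r")
      case True
      have "(a * r powr (a - 1)) * (K * r powr (- b)) = K * a * (r powr (a - 1) * r powr (- b))" by simp
      also have "r powr (a - 1) * r powr (- b) = r powr (a - b - 1)" using True s by (simp add: algebra_simps flip: powr_add)
      finally show ?thesis using a K True by (simp flip: ennreal_mult)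
    qed simp
  qed
  also have "\<dots> = ennreal (0 - K * a / (a - b) * s powr (a - b))"
  proof (rule nn_integral_FTC_atLeast)
    fix r assume "s \<le> r"
    then have "DERIV (\<lambda>r. K * a / (a - b) * r powr (a - b)) r :> K * a / (a - b) * ((a - b) * r powr (a - b - 1))"
      using s by (intro DERIV_cmult has_real_derivative_powr) auto
    then show "DERIV (\<lambda>r. K * a / (a - b) * r powr (a - b)) r :> K * a * r powr (a - b - 1)"
      using a by (simp add: mult.assoc)
  next
    show "((\<lambda>r. K * a / (a - b) * r powr (a - b)) \<longlongrightarrow> 0) at_top"
      using a by (intro tendsto_mult_right_zero tendsto_neg_powr filterlim_ident) auto
  qed (use s a K in \<open>auto simp: mult_nonneg_nonneg\<close>)
  also have "ennreal (s powr a) * ennreal (K * s powr (- b)) = ennreal (K * s powr (a - b))"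
    using s K by (simp flip: ennreal_mult powr_add add: mult_ac)
  also have "ennreal (K * s powr (a - b)) + ennreal (0 - K * a / (a - b) * s powr (a - b))
      = ennreal (K * s powr (a - b) + (0 - K * a / (a - b) * s powr (a - b)))"
    using K a by (subst ennreal_plus) (auto simp: divide_nonneg_neg zero_le_mult_iff mult_nonpos_nonneg divide_nonneg_nonpos)
  also have "K * s powr (a - b) + (0 - K * a / (a - b) * s powr (a - b)) = K * (b / (b - a)) * s powr (a - b)"
    using a by (simp add: field_simps)
  finally show ?thesis .
qed

subsection \<open>Truncations balanced against their level\<close>

text \<open>Intermediate value theorem for \<open>u * \<tau> - G u\<close>, where \<open>G u\<close>
  is the integral of the excess over \<open>u\<close>: the difference is \<open>-1\<close> at
  \<open>0\<close> and nonnegative at \<open>1 / \<tau>\<close>, as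
  \<open>G (1 / \<tau>) \<le> 1\<close>. Continuity holds because \<open>G\<close> is Lipschitz with
  the total mass as constant.\<close>

lemma exists_balanced_truncation:
  fixes F :: "'a \<Rightarrow> real"
  assumes "finite_measure M" and int: "integrable M F" and F: "\<And>x. 0 \<le> F x" "(\<integral>x. F x \<partial>M) = 1"
    and \<tau>: "0 < \<tau>"
  shows "\<exists>u>0. u * \<tau> = (\<integral>x. max (F x - u) 0 \<partial>M)"
proof -
  interpret finite_measure M by fact
  define G where "G = (\<lambda>u. \<integral>x. max (F x - u) 0 \<partial>M)"
  have I: "integrable M (\<lambda>x. max (F x - u) 0)" for u
    using int by (intro integrable_max) auto
  have "(measure M (space M))-lipschitz_on UNIV G"
  proof (rule lipschitz_onI)
    fix u v :: real
    have "dist (G u) (G v) = norm (\<integral>x. max (F x - u) 0 - max (F x - v) 0 \<partial>M)"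
      unfolding G_def dist_norm using I by simp
    also have "\<dots> \<le> (\<integral>x. norm (max (F x - u) 0 - max (F x - v) 0) \<partial>M)"
      by (rule integral_norm_bound)
    also have "\<dots> \<le> (\<integral>x. dist u v \<partial>M)"
      by (intro integral_mono) (use I in \<open>auto simp: dist_real_def max_def\<close>)
    finally show "dist (G u) (G v) \<le> measure M (space M) * dist u v" by simp
  qed simp
  then have "continuous_on UNIV G" by (rule lipschitz_on_continuous_on)
  then have "continuous_on {0..1/\<tau>} (\<lambda>u. u * \<tau> - G u)"
    by (intro continuous_intros) (auto intro: continuous_on_subset)
  moreover have "G 0 = 1" using F by (simp add: G_def max_absorb1)
  moreover have "G (1 / \<tau>) \<le> 1"
    unfolding G_def F(2)[symmetric] using \<tau> F(1) by (intro integral_mono I int) (auto simp: max_def)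
  ultimately obtain u where u: "0 \<le> u" "u * \<tau> - G u = 0"
    using IVT'[of "\<lambda>u. u * \<tau> - G u" 0 0 "1 / \<tau>"] \<tau> by auto
  moreover have "u \<noteq> 0" using u \<open>G 0 = 1\<close> by auto
  ultimately show ?thesis by (intro exI[of _ u]) (auto simp: G_def)
qed

text \<open>Superadditivity of \<open>powr p\<close>: a number \<open>y\<close> between
  \<open>0\<close> and \<open>x\<close> satisfies \<open>y powr p \<le> y * x powr (p - 1)\<close>,
  and this is added up for \<open>x - h\<close> and \<open>h\<close>.\<close>

lemma diff_powr_le_powr_diff:
  fixes x h p :: real
  assumes "1 \<le> p" "0 \<le> h" "h \<le> x"
  shows "(x - h) powr p \<le> x powr p - h powr p"
proof (cases "x = 0")
  case False
  then have x: "x > 0" using assms by auto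
  have *: "y powr p \<le> y * x powr (p - 1)" if "0 \<le> y" "y \<le> x" for y
  proof -
    have "y powr p = y * y powr (p - 1)" using that by (cases "y = 0") (auto simp: powr_diff)
    also have "\<dots> \<le> y * x powr (p - 1)" using that assms by (intro mult_left_mono powr_mono2) auto
    finally show ?thesis .
  qed
  have "(x - h) powr p + h powr p \<le> (x - h) * x powr (p - 1) + h * x powr (p - 1)"
    using assms by (intro add_mono *) auto
  also have "\<dots> = x powr p" using x by (simp add: powr_diff field_simps)
  finally show ?thesis by simp
qed (use assms in auto)

text \<open>Converts the first-power size of the excess over \<open>h\<close> into its
  \<open>p\<close>-th-power size, the quantity that the truncation level balances. The reason is
  \<open>x / h \<ge> 1\<close>.\<close>

lemma diff_le_powr_diff:
  fixes x h p :: real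
  assumes "1 \<le> p" "0 < h" "h \<le> x"
  shows "x - h \<le> (x powr p - h powr p) * h powr (1 - p)"
proof -
  have "x * 1 \<le> x * (x / h) powr (p - 1)"
    using assms by (intro mult_left_mono ge_one_powr_ge_zero) auto
  also have "\<dots> = x powr p * h powr (1 - p)"
    using assms by (simp add: powr_divide powr_diff)
  finally show ?thesis using assms by (simp add: left_diff_distrib flip: powr_add)
qed

text \<open>The balance is struck for \<open>F = f powr p\<close> at a threshold
  \<open>u n = h n powr p\<close> with \<open>u n = \<epsilon> n * exp n powr \<beta>\<close>. As
  \<open>\<beta> / p = \<beta> - 1\<close>, this one equation controls both mixed pieces by
  \<open>\<epsilon> n powr (1 / p)\<close>: \<open>h n * exp n powr (1 - \<beta>)\<close> for a
  large kernel against the truncated function, and \<open>exp n\<close> times the integral of the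
  excess for a small kernel.\<close>

lemma truncation_levels:
  fixes f :: "'a \<Rightarrow> real" and \<beta> p :: real
  assumes M: "finite_measure M" and [measurable]: "f \<in> borel_measurable M" and f0: "\<And>y. 0 \<le> f y"
    and f1: "(\<integral>\<^sup>+ y. ennreal (f y powr p) \<partial>M) = 1" and b: "1 < \<beta>" and p: "1 / \<beta> + 1 / p = 1"
  obtains \<epsilon> h :: "nat \<Rightarrow> real" where
    "\<And>n. 0 < \<epsilon> n" "\<And>n. \<epsilon> n \<le> 1" "\<And>n. 0 < h n" "\<And>i n. i \<le> n \<Longrightarrow> \<epsilon> n \<le> \<epsilon> i"
    "\<And>n. h n * exp (real n) powr (1 - \<beta>) = \<epsilon> n powr (1 / p)"
    "\<And>n. (\<integral>\<^sup>+ y. ennreal (min (f y) (h n) powr p) \<partial>M) \<le> ennreal (1 - \<epsilon> n)"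
    "\<And>n. (\<integral>\<^sup>+ y. ennreal (max (f y - h n) 0 powr p) \<partial>M) \<le> ennreal (\<epsilon> n)"
    "\<And>n. ennreal (exp (real n)) * (\<integral>\<^sup>+ y. ennreal (max (f y - h n) 0) \<partial>M) \<le> ennreal (\<epsilon> n powr (1 / p))"
proof -
  interpret finite_measure M by fact
  have pb: "p = \<beta> / (\<beta> - 1)"
  proof -
    have "1 / p = (\<beta> - 1) / \<beta>" using p b by (simp add: field_simps)
    then have "p = 1 / ((\<beta> - 1) / \<beta>)" by (metis div_by_1 divide_divide_eq_right mult_1)
    then show ?thesis by simp
  qed
  have p1: "1 < p" unfolding pb using b by simp
  define F where "F = (\<lambda>y. f y powr p)"
  have [measurable]: "F \<in> borel_measurable M" unfolding F_def by measurable
  have F0: "0 \<le> F y" for y by (simp add: F_def)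
  have int: "integrable M F"
    by (rule integrableI_nonneg) (use f1 F0 in \<open>auto simp: F_def\<close>)
  have F1: "(\<integral>y. F y \<partial>M) = 1"
    using f1 F0 by (subst integral_eq_nn_integral) (auto simp: F_def)
  define \<tau> where "\<tau> = (\<lambda>n::nat. exp (real n) powr (- \<beta>))"
  have \<tau>: "0 < \<tau> n" for n by (simp add: \<tau>_def)
  define G where "G = (\<lambda>u. \<integral>x. max (F x - u) 0 \<partial>M)"
  have I: "integrable M (\<lambda>x. max (F x - u) 0)" for u
    using int by (intro integrable_max) auto
  have G_mono: "G v \<le> G u" if "u \<le> v" for u v
    unfolding G_def using that by (intro integral_mono I) auto
  have "\<exists>u>0. u * \<tau> n = G u" for n
    unfolding G_def by (rule exists_balanced_truncation[OF M int F0 F1 \<tau>])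
  then obtain u where u: "\<And>n. 0 < u n" "\<And>n. u n * \<tau> n = G (u n)" by metis
  define \<epsilon> where "\<epsilon> = (\<lambda>n. G (u n))"
  define h where "h = (\<lambda>n. u n powr (1 / p))"
  have hp: "h n powr p = u n" for n using p1 u(1)[of n] by (simp add: h_def powr_powr)
  have h0: "0 < h n" for n using u(1)[of n] by (simp add: h_def)
  have u_eq: "u n = \<epsilon> n * exp (real n) powr \<beta>" for n
    using u(2)[of n] by (simp add: \<epsilon>_def \<tau>_def powr_minus field_simps)
  have \<epsilon>0: "0 < \<epsilon> n" for n unfolding \<epsilon>_def u(2)[symmetric] using u(1) \<tau> by simp
  have Gnn: "(\<integral>\<^sup>+ x. ennreal (max (F x - u n) 0) \<partial>M) = ennreal (\<epsilon> n)" for n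
    unfolding \<epsilon>_def G_def by (intro nn_integral_eq_integral I) auto
  have h_le: "h n \<le> f y \<longleftrightarrow> u n \<le> F y" for n y
    unfolding hp[symmetric] F_def using p1 f0[of y] h0[of n]
    by (metis less_le_not_le linorder_not_le order_less_trans powr_less_mono2 powr_mono2 zero_less_one)
  show ?thesis
  proof (rule that[of \<epsilon> h])
    fix n :: nat
    show "0 < \<epsilon> n" by (rule \<epsilon>0)
    show "0 < h n" by (rule h0)
    show "\<epsilon> n \<le> 1"
      unfolding \<epsilon>_def G_def F1[symmetric] using u(1)[of n] F0 by (intro integral_mono I int) (auto simp: max_def)
    have bp: "\<beta> * (1 / p) = \<beta> - 1" unfolding pb using b by simp
    have "h n = \<epsilon> n powr (1 / p) * exp (real n) powr (\<beta> * (1 / p))"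
      unfolding h_def u_eq by (simp add: powr_mult powr_powr)
    then show "h n * exp (real n) powr (1 - \<beta>) = \<epsilon> n powr (1 / p)"
      unfolding bp by (simp flip: powr_add)
    \<comment> \<open>Pointwise, \<open>min (f y) (h n) powr p\<close> is \<open>F y\<close> minus
      its excess over \<open>u n\<close>, so the integral is exactly
      \<open>1 - \<epsilon> n\<close>.\<close>
    have "(\<integral>\<^sup>+ y. ennreal (min (f y) (h n) powr p) \<partial>M) = (\<integral>\<^sup>+ y. ennreal (F y - max (F y - u n) 0) \<partial>M)"
    proof (intro nn_integral_cong arg_cong[of _ _ ennreal])
      fix y
      show "min (f y) (h n) powr p = F y - max (F y - u n) 0"
        using h_le[of n y] hp[of n] by (auto simp: min_def max_def F_def)
    qed
    also have "\<dots> = ennreal (\<integral>y. F y - max (F y - u n) 0 \<partial>M)"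
    proof (rule nn_integral_eq_integral)
      show "integrable M (\<lambda>y. F y - max (F y - u n) 0)" using I int by simp
      show "AE y in M. 0 \<le> F y - max (F y - u n) 0"
        using u(1)[of n] F0 by (auto simp: max_def less_imp_le)
    qed
    also have "\<dots> = ennreal (1 - \<epsilon> n)" using I int F1 by (simp add: \<epsilon>_def G_def)
    finally show "(\<integral>\<^sup>+ y. ennreal (min (f y) (h n) powr p) \<partial>M) \<le> ennreal (1 - \<epsilon> n)" by simp
    have "(\<integral>\<^sup>+ y. ennreal (max (f y - h n) 0 powr p) \<partial>M) \<le> (\<integral>\<^sup>+ x. ennreal (max (F x - u n) 0) \<partial>M)"
    proof (intro nn_integral_mono ennreal_leI)
      fix y
      show "max (f y - h n) 0 powr p \<le> max (F y - u n) 0"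
      proof (cases "h n \<le> f y")
        case True
        then show ?thesis
          using diff_powr_le_powr_diff[of p "h n" "f y"] p1 h0[of n] hp[of n] h_le[of n y]
          by (simp add: max_absorb1 F_def)
      qed (simp add: max_absorb2)
    qed
    then show "(\<integral>\<^sup>+ y. ennreal (max (f y - h n) 0 powr p) \<partial>M) \<le> ennreal (\<epsilon> n)" by (simp add: Gnn)
    have "(\<integral>\<^sup>+ y. ennreal (max (f y - h n) 0) \<partial>M) \<le> (\<integral>\<^sup>+ x. ennreal (max (F x - u n) 0) * ennreal (h n powr (1 - p)) \<partial>M)"
    proof (intro nn_integral_mono)
      fix y
      have "max (f y - h n) 0 \<le> max (F y - u n) 0 * h n powr (1 - p)"
      proof (cases "h n \<le> f y")
        case True
        have "f y - h n \<le> (F y - u n) * h n powr (1 - p)"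
          using diff_le_powr_diff[of p "h n" "f y"] p1 h0[of n] True by (simp add: hp F_def)
        then show ?thesis using True h_le[of n y] by (simp add: max_absorb1)
      qed (simp add: max_absorb2)
      then show "ennreal (max (f y - h n) 0) \<le> ennreal (max (F y - u n) 0) * ennreal (h n powr (1 - p))"
        by (simp add: ennreal_leI flip: ennreal_mult)
    qed
    also have "\<dots> = ennreal (\<epsilon> n * h n powr (1 - p))"
      using \<epsilon>0[of n] by (simp add: nn_integral_multc Gnn ennreal_mult)
    finally have "ennreal (exp (real n)) * (\<integral>\<^sup>+ y. ennreal (max (f y - h n) 0) \<partial>M)
        \<le> ennreal (exp (real n)) * ennreal (\<epsilon> n * h n powr (1 - p))"
      by (rule mult_left_mono) simp
    also have "\<dots> = ennreal (exp (real n) * (\<epsilon> n * h n powr (1 - p)))"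
      using \<epsilon>0[of n] by (simp add: ennreal_mult)
    \<comment> \<open>With \<open>h n\<close> expressed through \<open>\<epsilon> n\<close>, the
      powers of \<open>exp n\<close> cancel because
      \<open>\<beta> * (1 / p - 1) = -1\<close>.\<close>
    also have "h n powr (1 - p) = \<epsilon> n powr ((1 - p) / p) * exp (real n) powr (\<beta> * ((1 - p) / p))"
      unfolding h_def u_eq by (simp add: powr_mult powr_powr)
    also have "(1 - p) / p = 1 / p - 1" using p1 by (simp add: field_simps)
    also have "\<beta> * (1 / p - 1) = - 1" using bp by (simp add: algebra_simps)
    also have "exp (real n) * (\<epsilon> n * (\<epsilon> n powr (1 / p - 1) * exp (real n) powr - 1)) = \<epsilon> n powr (1 / p)"
      using \<epsilon>0[of n] by (simp add: powr_diff powr_minus field_simps)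
    finally show "ennreal (exp (real n)) * (\<integral>\<^sup>+ y. ennreal (max (f y - h n) 0) \<partial>M) \<le> ennreal (\<epsilon> n powr (1 / p))" .
  next
    fix i n :: nat assume "i \<le> n"
    then have \<tau>_le: "\<tau> n \<le> \<tau> i" using b by (simp add: \<tau>_def exp_powr_real)
    \<comment> \<open>The balance point moves up with \<open>n\<close>: the weight
      \<open>\<tau>\<close> decreases in \<open>n\<close> and \<open>G\<close> decreases in
      \<open>u\<close>, so \<open>u i > u n\<close> would contradict the two balance
      equations.\<close>
    have "u i \<le> u n"
    proof (rule ccontr)
      assume "\<not> u i \<le> u n"
      then have "G (u i) \<le> G (u n)" by (intro G_mono) auto
      then have "u i * \<tau> i \<le> u n * \<tau> n" by (simp add: u(2))
      also have "\<dots> \<le> u n * \<tau> i" using \<tau>_le u(1)[of n] by (intro mult_left_mono) auto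
      also have "\<dots> < u i * \<tau> i" using \<open>\<not> u i \<le> u n\<close> \<tau>[of i] by simp
      finally show False by simp
    qed
    then show "\<epsilon> n \<le> \<epsilon> i" unfolding \<epsilon>_def by (rule G_mono)
  qed
qed

subsection \<open>The kernel estimate\<close>

text \<open>Pointwise, by the size of \<open>g y\<close>: up to \<open>s1\<close>, cut
  \<open>f\<close> at \<open>h1\<close> and bound the kernel by \<open>s1\<close> on the excess;
  between \<open>s1\<close> and \<open>s2\<close>, use \<open>f \<le> h1 + max (f - h1) 0\<close>;
  above \<open>s2\<close>, cut at \<open>h2\<close> alone. The first two integrals will be the main
  terms, the four in parentheses the errors.\<close>

lemma two_level_split:
  fixes f g :: "'a \<Rightarrow> real" and h1 h2 s1 s2 :: real
  assumes [measurable]: "f \<in> borel_measurable M" "g \<in> borel_measurable M"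
    and nn: "\<And>y. y \<in> space M \<Longrightarrow> 0 \<le> g y" "\<And>y. 0 \<le> f y" "0 \<le> h1" "0 \<le> h2" and s: "s1 \<le> s2"
  shows "(\<integral>\<^sup>+ y. ennreal (g y * f y) \<partial>M) \<le>
      (\<integral>\<^sup>+ y. ennreal (g y * indicator {y. g y \<le> s1} y * min (f y) h1) \<partial>M)
    + (\<integral>\<^sup>+ y. ennreal (g y * indicator {y. s1 < g y \<and> g y \<le> s2} y * max (f y - h1) 0) \<partial>M)
    + (ennreal h1 * (\<integral>\<^sup>+ y. ennreal (g y) * indicator {y. s1 < g y} y \<partial>M)
    + ennreal s1 * (\<integral>\<^sup>+ y. ennreal (max (f y - h1) 0) \<partial>M)
    + ennreal h2 * (\<integral>\<^sup>+ y. ennreal (g y) * indicator {y. s2 < g y} y \<partial>M)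
    + (\<integral>\<^sup>+ y. ennreal (g y * indicator {y. s2 < g y} y * max (f y - h2) 0) \<partial>M))"
    (is "_ \<le> ?R")
proof -
  have "(\<integral>\<^sup>+ y. ennreal (g y * f y) \<partial>M) \<le> (\<integral>\<^sup>+ y.
      ennreal (g y * indicator {y. g y \<le> s1} y * min (f y) h1)
    + ennreal (g y * indicator {y. s1 < g y \<and> g y \<le> s2} y * max (f y - h1) 0)
    + (ennreal h1 * (ennreal (g y) * indicator {y. s1 < g y} y)
    + ennreal s1 * ennreal (max (f y - h1) 0)
    + ennreal h2 * (ennreal (g y) * indicator {y. s2 < g y} y)
    + ennreal (g y * indicator {y. s2 < g y} y * max (f y - h2) 0)) \<partial>M)"
  proof (rule nn_integral_mono)
    fix y assume y: "y \<in> space M"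
    define a b c where "a = min (f y) h1" and "b = max (f y - h1) 0" and "c = max (f y - h2) 0"
    have abc: "0 \<le> a" "0 \<le> b" "0 \<le> c" "f y = a + b" "a \<le> h1" "b \<le> f y" "f y \<le> c + h2"
      using nn by (auto simp: a_def b_def c_def)
    have g: "0 \<le> g y" using nn y by auto
    consider "g y \<le> s1" | "s1 < g y" "g y \<le> s2" | "s2 < g y" "s1 < g y" using s by linarith
    then show "ennreal (g y * f y) \<le>
      ennreal (g y * indicator {y. g y \<le> s1} y * min (f y) h1)
    + ennreal (g y * indicator {y. s1 < g y \<and> g y \<le> s2} y * max (f y - h1) 0)
    + (ennreal h1 * (ennreal (g y) * indicator {y. s1 < g y} y)
    + ennreal s1 * ennreal (max (f y - h1) 0)
    + ennreal h2 * (ennreal (g y) * indicator {y. s2 < g y} y)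
    + ennreal (g y * indicator {y. s2 < g y} y * max (f y - h2) 0))"
      unfolding a_def[symmetric] b_def[symmetric] c_def[symmetric]
    proof cases
      case 1
      have "g y * f y \<le> g y * a + s1 * b"
        unfolding abc(4) distrib_left using 1 g abc by (intro add_left_mono mult_right_mono)
      then have "ennreal (g y * f y) \<le> ennreal (g y * a) + ennreal s1 * ennreal b"
        using g abc 1 by (simp flip: ennreal_mult ennreal_plus)
      then show "ennreal (g y * f y) \<le>
          ennreal (g y * indicator {y. g y \<le> s1} y * a)
        + ennreal (g y * indicator {y. s1 < g y \<and> g y \<le> s2} y * b)
        + (ennreal h1 * (ennreal (g y) * indicator {y. s1 < g y} y)
        + ennreal s1 * ennreal b
        + ennreal h2 * (ennreal (g y) * indicator {y. s2 < g y} y)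
        + ennreal (g y * indicator {y. s2 < g y} y * c))"
        using 1 s by simp
    next
      case 2
      have "g y * f y \<le> h1 * g y + g y * b"
        unfolding abc(4) distrib_left using g abc
        by (intro add_mono) (auto simp: mult.commute intro: mult_right_mono)
      then have "ennreal (g y * f y) \<le> ennreal h1 * ennreal (g y) + ennreal (g y * b)"
        using g abc nn by (simp flip: ennreal_mult ennreal_plus)
      also have "\<dots> \<le> ennreal (g y * b) + (ennreal h1 * ennreal (g y) + ennreal s1 * ennreal b)"
        by (simp add: add_ac add_increasing2)
      finally show "ennreal (g y * f y) \<le>
          ennreal (g y * indicator {y. g y \<le> s1} y * a)
        + ennreal (g y * indicator {y. s1 < g y \<and> g y \<le> s2} y * b)
        + (ennreal h1 * (ennreal (g y) * indicator {y. s1 < g y} y)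
        + ennreal s1 * ennreal b
        + ennreal h2 * (ennreal (g y) * indicator {y. s2 < g y} y)
        + ennreal (g y * indicator {y. s2 < g y} y * c))"
        using 2 by simp
    next
      case 3
      have "g y * f y \<le> g y * (h2 + c)"
        using g abc by (intro mult_left_mono) auto
      then have "ennreal (g y * f y) \<le> ennreal h2 * ennreal (g y) + ennreal (g y * c)"
        using g abc nn by (simp add: algebra_simps flip: ennreal_mult ennreal_plus)
      also have "\<dots> \<le> (ennreal h1 * ennreal (g y) + ennreal s1 * ennreal b) + (ennreal h2 * ennreal (g y) + ennreal (g y * c))"
        by (rule add_increasing) auto
      finally show "ennreal (g y * f y) \<le>
          ennreal (g y * indicator {y. g y \<le> s1} y * a)
        + ennreal (g y * indicator {y. s1 < g y \<and> g y \<le> s2} y * b)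
        + (ennreal h1 * (ennreal (g y) * indicator {y. s1 < g y} y)
        + ennreal s1 * ennreal b
        + ennreal h2 * (ennreal (g y) * indicator {y. s2 < g y} y)
        + ennreal (g y * indicator {y. s2 < g y} y * c))"
        using 3 by (simp add: add_ac)
    qed
  qed
  also have "\<dots> = ?R"
    by (simp add: nn_integral_add nn_integral_cmult)
  finally show ?thesis .
qed

text \<open>The sharp constant \<open>A * \<beta>\<close> sits in \<open>low\<close> and
  \<open>band\<close>, whose error \<open>c\<close> is additive and the same at all levels.
  \<open>K1\<close> and \<open>K2\<close> may be crude: they affect only error terms and the sizes
  of exceptional sets.\<close>

locale Adams_kernel = M: finite_measure M + N: finite_measure N
  for M :: "'m measure" and N :: "'n measure" +
  fixes \<kappa> :: "'n \<Rightarrow> 'm \<Rightarrow> real" and \<beta> p \<beta>0 A c K1 K2 :: real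
  assumes \<kappa>_measurable: "(\<lambda>(x, y). \<kappa> x y) \<in> borel_measurable (N \<Otimes>\<^sub>M M)"
    and \<kappa>_nonneg: "0 \<le> \<kappa> x y"
    and \<beta>: "1 < \<beta>" and p: "1 / \<beta> + 1 / p = 1" and \<beta>0: "0 < \<beta>0" and A: "0 < A"
    and c: "0 \<le> c" and K1: "0 \<le> K1" and K2: "0 \<le> K2"
    and tail1: "\<lbrakk>x \<in> space N; 0 < r\<rbrakk> \<Longrightarrow> emeasure M {y \<in> space M. r < \<kappa> x y} \<le> ennreal (K1 * r powr (- \<beta>))"
    and tail2: "\<lbrakk>y \<in> space M; 0 < r\<rbrakk> \<Longrightarrow> emeasure N {x \<in> space N. r < \<kappa> x y} \<le> ennreal (K2 * r powr (- \<beta>0))"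
    and low: "\<lbrakk>x \<in> space N; 1 \<le> s\<rbrakk> \<Longrightarrow>
      (\<integral>\<^sup>+ y. ennreal (\<kappa> x y powr \<beta>) * indicator {y. \<kappa> x y \<le> s} y \<partial>M) \<le> ennreal (A * \<beta> * ln s + c)"
    and band: "\<lbrakk>x \<in> space N; 1 \<le> s; s \<le> t\<rbrakk> \<Longrightarrow>
      (\<integral>\<^sup>+ y. ennreal (\<kappa> x y powr \<beta>) * indicator {y. s < \<kappa> x y \<and> \<kappa> x y \<le> t} y \<partial>M) \<le> ennreal (A * \<beta> * ln (t / s) + c)"
begin

lemma measurable_sections [measurable]:
  "x \<in> space N \<Longrightarrow> (\<lambda>y. \<kappa> x y) \<in> borel_measurable M"
  "y \<in> space M \<Longrightarrow> (\<lambda>x. \<kappa> x y) \<in> borel_measurable N"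
  using measurable_compose[OF measurable_Pair1' \<kappa>_measurable] measurable_compose[OF measurable_Pair2' \<kappa>_measurable]
  by auto

lemma one_over_p: "1 / p = 1 - 1 / \<beta>"
  using p by simp

lemma p_gt_1: "1 < p"
proof -
  have "0 < 1 / p" "1 / p < 1" unfolding one_over_p using \<beta> by auto
  then show ?thesis by (cases "p > 0") (auto simp: field_simps)
qed

text \<open>Hoelder after writing \<open>\<kappa> = \<kappa>\<^bsup>a/\<beta>\<^esup> \<kappa>\<^bsup>b/p\<^esup>\<close> with \<open>a < \<beta>\<close>, \<open>b < \<beta>0\<close>; unlike
  an \<open>L\<^bsup>1\<^esup>\<close> estimate, this converges for \<open>\<beta>0 \<le> 1\<close> too.\<close>

lemma tail_operator_small:
  obtains K where "0 \<le> K"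
    "\<And>v \<epsilon> s. \<lbrakk>v \<in> borel_measurable M; \<And>y. 0 \<le> v y; 0 < \<epsilon>; 0 < s; (\<integral>\<^sup>+ y. ennreal (v y powr p) \<partial>M) \<le> ennreal \<epsilon>\<rbrakk>
      \<Longrightarrow> \<exists>E\<in>sets N. emeasure N E \<le> ennreal (K * s powr (- \<beta>0)) \<and>
        (\<forall>x\<in>space N - E. (\<integral>\<^sup>+ y. ennreal (\<kappa> x y * indicator {y. s < \<kappa> x y} y * v y) \<partial>M) \<le> ennreal (\<epsilon> powr (1 / p)))"
proof -
  \<comment> \<open>\<open>b < \<beta>0\<close> makes the integral in \<open>x\<close> converge, and
    \<open>b > 0\<close> gives \<open>a < \<beta>\<close>, which does the same in \<open>y\<close>.
    Positivity of \<open>a\<close> needs \<open>b < p\<close>, and this follows from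
    \<open>b < 1\<close>.\<close>
  define b where "b = min \<beta>0 1 / 2"
  define a where "a = \<beta> - \<beta> * (b / p)"
  have b: "0 < b" "b < \<beta>0" "b < p" using \<beta>0 p_gt_1 by (auto simp: b_def min_def)
  have a: "0 < a" "a < \<beta>" using b \<beta> p_gt_1 by (auto simp: a_def field_simps)
  have ab: "a / \<beta> + b / p = 1" using \<beta> by (simp add: a_def diff_divide_distrib)
  \<comment> \<open>The summand \<open>1\<close> keeps \<open>L1\<close> positive even if
    \<open>K1 = 0\<close>, so that its powers cancel below.\<close>
  define L1 where "L1 = K1 * (\<beta> / (\<beta> - a)) + 1"
  define L2 where "L2 = K2 * (\<beta>0 / (\<beta>0 - b))"
  have L: "0 < L1" "0 \<le> L2"
    using a b K1 K2 \<beta> \<beta>0 by (auto simp: L1_def L2_def intro!: add_nonneg_pos)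
  show ?thesis
  proof (rule that[of "L1 powr (p / \<beta>) * L2"])
    show "0 \<le> L1 powr (p / \<beta>) * L2" using L by simp
    fix v :: "'m \<Rightarrow> real" and \<epsilon> s :: real
    assume v[measurable]: "v \<in> borel_measurable M" and v0: "\<And>y. 0 \<le> v y" and \<epsilon>: "0 < \<epsilon>" and s: "0 < s"
      and v\<epsilon>: "(\<integral>\<^sup>+ y. ennreal (v y powr p) \<partial>M) \<le> ennreal \<epsilon>"
    note \<kappa>_measurable[measurable]
    \<comment> \<open>\<open>H x\<close> is the integral of the \<open>p\<close>-th power of the
      second Hoelder factor. After interchanging the integrals, \<open>tail2\<close> bounds its
      total over \<open>x\<close> for each fixed \<open>y\<close>.\<close>
    define w where "w = (\<lambda>x y. ennreal (\<kappa> x y powr b) * indicator {y. s < \<kappa> x y} y * ennreal (v y powr p))"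
    define H where "H = (\<lambda>x. \<integral>\<^sup>+ y. w x y \<partial>M)"
    have w_eq: "w x y = (if s < \<kappa> x y then ennreal (\<kappa> x y powr b) * ennreal (v y powr p) else 0)" for x y
      by (simp add: w_def)
    have wm[measurable]: "(\<lambda>(x, y). w x y) \<in> borel_measurable (N \<Otimes>\<^sub>M M)"
      unfolding w_eq by measurable
    have Hm[measurable]: "H \<in> borel_measurable N" unfolding H_def by measurable
    \<comment> \<open>\<open>\<eta>\<close> is the value of \<open>H x\<close> for which Hoelder
      gives exactly \<open>\<epsilon> powr (1 / p)\<close>. In Markov's inequality for
      \<open>H \<ge> \<eta>\<close> the factor \<open>\<epsilon>\<close> cancels and the powers of
      \<open>s\<close> combine to \<open>s powr (- \<beta>0)\<close>.\<close>
    define \<eta> where "\<eta> = \<epsilon> * L1 powr (- (p / \<beta>)) * s powr b"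
    have \<eta>: "0 < \<eta>" using \<epsilon> L s by (simp add: \<eta>_def)
    define E where "E = {x \<in> space N. 1 \<le> ennreal (1 / \<eta>) * H x}"
    have E[measurable]: "E \<in> sets N" unfolding E_def by measurable
    interpret pair_sigma_finite N M ..
    have "(\<integral>\<^sup>+ x. H x \<partial>N) = (\<integral>\<^sup>+ y. (\<integral>\<^sup>+ x. w x y \<partial>N) \<partial>M)"
      unfolding H_def using Fubini'[OF wm] by simp
    also have "\<dots> \<le> (\<integral>\<^sup>+ y. ennreal (L2 * s powr (b - \<beta>0)) * ennreal (v y powr p) \<partial>M)"
    proof (rule nn_integral_mono)
      fix y assume y: "y \<in> space M"
      have [measurable]: "(\<lambda>x. \<kappa> x y) \<in> borel_measurable N" using y by measurable
      have "(\<integral>\<^sup>+ x. w x y \<partial>N) = (\<integral>\<^sup>+ x. ennreal (\<kappa> x y powr b) * indicator {x. s < \<kappa> x y} x * ennreal (v y powr p) \<partial>N)"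
        by (simp add: w_def indicator_def)
      also have "\<dots> = (\<integral>\<^sup>+ x. ennreal (\<kappa> x y powr b) * indicator {x. s < \<kappa> x y} x \<partial>N) * ennreal (v y powr p)"
        by (rule nn_integral_multc) measurable
      also have "\<dots> \<le> ennreal (K2 * (\<beta>0 / (\<beta>0 - b)) * s powr (b - \<beta>0)) * ennreal (v y powr p)"
        by (intro mult_right_mono nn_integral_powr_tail_le N.sigma_finite_measure_axioms tail2 y b s K2) auto
      finally show "(\<integral>\<^sup>+ x. w x y \<partial>N) \<le> ennreal (L2 * s powr (b - \<beta>0)) * ennreal (v y powr p)"
        by (simp add: L2_def)
    qed
    also have "\<dots> \<le> ennreal (L2 * s powr (b - \<beta>0)) * ennreal \<epsilon>"
      using v\<epsilon> by (simp add: nn_integral_cmult mult_left_mono)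
    finally have H_int: "(\<integral>\<^sup>+ x. H x \<partial>N) \<le> ennreal (L2 * s powr (b - \<beta>0) * \<epsilon>)"
      using L \<epsilon> by (simp add: ennreal_mult)
    have "emeasure N E \<le> ennreal (1 / \<eta>) * (\<integral>\<^sup>+ x. H x * indicator (space N) x \<partial>N)"
      unfolding E_def by (rule nn_integral_Markov_inequality) auto
    also have "(\<integral>\<^sup>+ x. H x * indicator (space N) x \<partial>N) = (\<integral>\<^sup>+ x. H x \<partial>N)"
      by (intro nn_integral_cong) simp
    also have "ennreal (1 / \<eta>) * (\<integral>\<^sup>+ x. H x \<partial>N) \<le> ennreal (1 / \<eta>) * ennreal (L2 * s powr (b - \<beta>0) * \<epsilon>)"
      using H_int by (rule mult_left_mono) simp
    also have "\<dots> = ennreal (1 / \<eta> * (L2 * s powr (b - \<beta>0) * \<epsilon>))"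
      using \<eta> L \<epsilon> by (intro ennreal_mult[symmetric]) auto
    also have "1 / \<eta> * (L2 * s powr (b - \<beta>0) * \<epsilon>) = L1 powr (p / \<beta>) * L2 * s powr (- \<beta>0)"
      using \<epsilon> L s by (simp add: \<eta>_def powr_minus powr_diff field_simps)
    finally have E_le: "emeasure N E \<le> ennreal (L1 powr (p / \<beta>) * L2 * s powr (- \<beta>0))" .
    have "(\<integral>\<^sup>+ y. ennreal (\<kappa> x y * indicator {y. s < \<kappa> x y} y * v y) \<partial>M) \<le> ennreal (\<epsilon> powr (1 / p))"
      if x: "x \<in> space N - E" for x
    proof -
      have [measurable]: "(\<lambda>y. \<kappa> x y) \<in> borel_measurable M"
        using x by (intro measurable_sections) auto
      have "ennreal (1 / \<eta>) * H x \<le> 1" using x by (auto simp: E_def)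
      then have "ennreal \<eta> * (ennreal (1 / \<eta>) * H x) \<le> ennreal \<eta> * 1" by (rule mult_left_mono) simp
      then have Hx: "H x \<le> ennreal \<eta>" using \<eta> by (simp flip: mult.assoc ennreal_mult)
      define u1 where "u1 = (\<lambda>y. \<kappa> x y powr (a / \<beta>) * indicator {y. s < \<kappa> x y} y)"
      define u2 where "u2 = (\<lambda>y. \<kappa> x y powr (b / p) * indicator {y. s < \<kappa> x y} y * v y)"
      define d where "d = L1 * s powr (a - \<beta>)"
      have d0: "0 \<le> d" using L by (simp add: d_def)
      have "(\<integral>\<^sup>+ y. ennreal (u1 y * u2 y) \<partial>M) \<le> ennreal (d powr (1 / \<beta>) * \<eta> powr (1 / p))"
      proof (rule nn_integral_Holder_inequality)
        have "(\<integral>\<^sup>+ y. ennreal (u1 y powr \<beta>) \<partial>M) = (\<integral>\<^sup>+ y. ennreal (\<kappa> x y powr a) * indicator {y. s < \<kappa> x y} y \<partial>M)"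
          by (intro nn_integral_cong) (use \<beta> in \<open>auto simp: u1_def powr_powr indicator_def\<close>)
        also have "\<dots> \<le> ennreal (K1 * (\<beta> / (\<beta> - a)) * s powr (a - \<beta>))"
          using x by (intro nn_integral_powr_tail_le M.sigma_finite_measure_axioms tail1 a s K1) auto
        also have "\<dots> \<le> ennreal d" by (intro ennreal_leI) (simp add: d_def L1_def distrib_right)
        finally show "(\<integral>\<^sup>+ y. ennreal (u1 y powr \<beta>) \<partial>M) \<le> ennreal d" .
        have "(\<integral>\<^sup>+ y. ennreal (u2 y powr p) \<partial>M) = H x"
          unfolding H_def w_def
          by (intro nn_integral_cong) (use p_gt_1 v0 in \<open>auto simp: u2_def powr_powr powr_mult indicator_def ennreal_mult\<close>)
        then show "(\<integral>\<^sup>+ y. ennreal (u2 y powr p) \<partial>M) \<le> ennreal \<eta>" using Hx by simp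
      qed (use \<eta> d0 \<beta> p p_gt_1 v0 in \<open>auto simp: u1_def u2_def\<close>)
      also have "(\<integral>\<^sup>+ y. ennreal (u1 y * u2 y) \<partial>M) = (\<integral>\<^sup>+ y. ennreal (\<kappa> x y * indicator {y. s < \<kappa> x y} y * v y) \<partial>M)"
      proof (intro nn_integral_cong arg_cong[of _ _ ennreal])
        fix y
        have "\<kappa> x y powr (a / \<beta>) * \<kappa> x y powr (b / p) = \<kappa> x y"
          unfolding powr_add[symmetric] ab using \<kappa>_nonneg[of x y] by simp
        then show "u1 y * u2 y = \<kappa> x y * indicator {y. s < \<kappa> x y} y * v y"
          by (simp add: u1_def u2_def indicator_def flip: mult.assoc)
      qed
      also have "d powr (1 / \<beta>) * \<eta> powr (1 / p) = \<epsilon> powr (1 / p)"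
      proof -
        have e1: "(a - \<beta>) / \<beta> + b / p = 0" using ab \<beta> by (simp add: diff_divide_distrib)
        have "d powr (1 / \<beta>) * \<eta> powr (1 / p) = L1 powr (1 / \<beta>) * s powr ((a - \<beta>) / \<beta>)
            * (\<epsilon> powr (1 / p) * L1 powr (- (1 / \<beta>)) * s powr (b / p))"
          using p_gt_1 by (simp add: d_def \<eta>_def powr_mult powr_powr)
        also have "\<dots> = (L1 powr (1 / \<beta>) * L1 powr (- (1 / \<beta>))) * (s powr ((a - \<beta>) / \<beta>) * s powr (b / p)) * \<epsilon> powr (1 / p)"
          by (simp only: mult_ac)
        also have "\<dots> = \<epsilon> powr (1 / p)"
          unfolding powr_add[symmetric] e1 using L s by simp
        finally show ?thesis .
      qed
      finally show ?thesis .
    qed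
    then show "\<exists>E\<in>sets N. emeasure N E \<le> ennreal (L1 powr (p / \<beta>) * L2 * s powr (- \<beta>0)) \<and>
        (\<forall>x\<in>space N - E. (\<integral>\<^sup>+ y. ennreal (\<kappa> x y * indicator {y. s < \<kappa> x y} y * v y) \<partial>M) \<le> ennreal (\<epsilon> powr (1 / p)))"
      using E E_le by blast
  qed
qed

text \<open>\<open>two_level_split\<close> at the levels \<open>i\<close> and \<open>i + m\<close>.
  Hoelder with \<open>low\<close> and \<open>band\<close> treats the two main terms; the four errors
  are multiples of \<open>\<epsilon> i powr (1 / p)\<close>, those of level \<open>i + m\<close>
  because \<open>\<epsilon>\<close> decreases. Only \<open>rest\<close> restricts \<open>x\<close>
  beyond membership in \<open>space N\<close>, and it depends on \<open>i + m\<close> alone, not on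
  the splitting.\<close>

lemma two_level_bound:
  fixes f :: "'m \<Rightarrow> real" and \<epsilon> h :: "nat \<Rightarrow> real"
  assumes f[measurable]: "f \<in> borel_measurable M" and f0: "\<And>y. 0 \<le> f y"
    and \<epsilon>: "\<And>n. 0 < \<epsilon> n" "\<And>n. \<epsilon> n \<le> 1" and h: "\<And>n. 0 < h n" and anti: "\<And>i n. i \<le> n \<Longrightarrow> \<epsilon> n \<le> \<epsilon> i"
    and h_eq: "\<And>n. h n * exp (real n) powr (1 - \<beta>) = \<epsilon> n powr (1 / p)"
    and lower: "\<And>n. (\<integral>\<^sup>+ y. ennreal (min (f y) (h n) powr p) \<partial>M) \<le> ennreal (1 - \<epsilon> n)"
    and upper: "\<And>n. (\<integral>\<^sup>+ y. ennreal (max (f y - h n) 0 powr p) \<partial>M) \<le> ennreal (\<epsilon> n)"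
    and upper1: "\<And>n. ennreal (exp (real n)) * (\<integral>\<^sup>+ y. ennreal (max (f y - h n) 0) \<partial>M) \<le> ennreal (\<epsilon> n powr (1 / p))"
    and x: "x \<in> space N"
    and rest: "(\<integral>\<^sup>+ y. ennreal (\<kappa> x y * indicator {y. exp (real (i + m)) < \<kappa> x y} y * max (f y - h (i + m)) 0) \<partial>M)
      \<le> ennreal (\<epsilon> (i + m) powr (1 / p))"
  shows "(\<integral>\<^sup>+ y. ennreal (\<kappa> x y * f y) \<partial>M) \<le>
      ennreal ((A * \<beta> * real i + c) powr (1 / \<beta>) * (1 - \<epsilon> i) powr (1 / p)
        + ((A * \<beta> * real m + c) powr (1 / \<beta>) + (2 * (K1 * (\<beta> / (\<beta> - 1))) + 2)) * \<epsilon> i powr (1 / p))"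
proof -
  define s where "s = (\<lambda>n. exp (real n))"
  define Kt where "Kt = K1 * (\<beta> / (\<beta> - 1))"
  define e where "e = \<epsilon> i powr (1 / p)"
  have Kt: "0 \<le> Kt" using K1 \<beta> by (simp add: Kt_def)
  have e: "0 \<le> e" by (simp add: e_def)
  have s1: "1 \<le> s n" for n by (simp add: s_def)
  have s_mono: "s i \<le> s (i + m)" by (simp add: s_def)
  have AB: "0 \<le> A * \<beta> * real n + c" for n using A \<beta> c by simp
  have [measurable]: "(\<lambda>y. \<kappa> x y) \<in> borel_measurable M" using x by measurable
  have e_le: "\<epsilon> (i + m) powr (1 / p) \<le> e"
    unfolding e_def using anti[of i "i + m"] \<epsilon>(1)[of "i + m"] p_gt_1 by (intro powr_mono2) auto
  have I1: "(\<integral>\<^sup>+ y. ennreal (\<kappa> x y * indicator {y. \<kappa> x y \<le> s i} y * min (f y) (h i)) \<partial>M)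
      \<le> ennreal ((A * \<beta> * real i + c) powr (1 / \<beta>) * (1 - \<epsilon> i) powr (1 / p))"
  proof (rule nn_integral_Holder_inequality[OF _ _ _ _ AB _ \<beta> p_gt_1 p _ lower])
    have "(\<integral>\<^sup>+ y. ennreal ((\<kappa> x y * indicator {y. \<kappa> x y \<le> s i} y) powr \<beta>) \<partial>M)
        = (\<integral>\<^sup>+ y. ennreal (\<kappa> x y powr \<beta>) * indicator {y. \<kappa> x y \<le> s i} y \<partial>M)"
      by (intro nn_integral_cong) (auto simp: indicator_def)
    also have "\<dots> \<le> ennreal (A * \<beta> * ln (s i) + c)" by (rule low[OF x s1])
    finally show "(\<integral>\<^sup>+ y. ennreal ((\<kappa> x y * indicator {y. \<kappa> x y \<le> s i} y) powr \<beta>) \<partial>M)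
        \<le> ennreal (A * \<beta> * real i + c)" by (simp add: s_def)
  qed (use \<epsilon>(2)[of i] f0 h[of i] \<kappa>_nonneg in \<open>auto simp: less_imp_le\<close>)
  have I2: "(\<integral>\<^sup>+ y. ennreal (\<kappa> x y * indicator {y. s i < \<kappa> x y \<and> \<kappa> x y \<le> s (i + m)} y * max (f y - h i) 0) \<partial>M)
      \<le> ennreal ((A * \<beta> * real m + c) powr (1 / \<beta>) * e)"
    unfolding e_def
  proof (rule nn_integral_Holder_inequality[OF _ _ _ _ AB _ \<beta> p_gt_1 p _ upper])
    have "(\<integral>\<^sup>+ y. ennreal ((\<kappa> x y * indicator {y. s i < \<kappa> x y \<and> \<kappa> x y \<le> s (i + m)} y) powr \<beta>) \<partial>M)
        = (\<integral>\<^sup>+ y. ennreal (\<kappa> x y powr \<beta>) * indicator {y. s i < \<kappa> x y \<and> \<kappa> x y \<le> s (i + m)} y \<partial>M)"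
      by (intro nn_integral_cong) (auto simp: indicator_def)
    also have "\<dots> \<le> ennreal (A * \<beta> * ln (s (i + m) / s i) + c)" by (rule band[OF x s1 s_mono])
    finally show "(\<integral>\<^sup>+ y. ennreal ((\<kappa> x y * indicator {y. s i < \<kappa> x y \<and> \<kappa> x y \<le> s (i + m)} y) powr \<beta>) \<partial>M)
        \<le> ennreal (A * \<beta> * real m + c)" by (simp add: s_def exp_add)
  qed (use \<epsilon>(1)[of i] \<kappa>_nonneg in \<open>auto simp: less_imp_le\<close>)
  \<comment> \<open>The tail estimate with exponent \<open>1 < \<beta>\<close>; the balance
    \<open>h_eq\<close> then turns \<open>h n * s n powr (1 - \<beta>)\<close> into
    \<open>\<epsilon> n powr (1 / p)\<close>.\<close>
  have T: "ennreal (h n) * (\<integral>\<^sup>+ y. ennreal (\<kappa> x y) * indicator {y. s n < \<kappa> x y} y \<partial>M) \<le> ennreal (Kt * \<epsilon> n powr (1 / p))" for n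
  proof -
    have "(\<integral>\<^sup>+ y. ennreal (\<kappa> x y powr 1) * indicator {y. s n < \<kappa> x y} y \<partial>M) \<le> ennreal (Kt * s n powr (1 - \<beta>))"
      unfolding Kt_def
      by (intro nn_integral_powr_tail_le M.sigma_finite_measure_axioms tail1 K1 x) (use \<beta> s1[of n] in auto)
    then have "ennreal (h n) * (\<integral>\<^sup>+ y. ennreal (\<kappa> x y) * indicator {y. s n < \<kappa> x y} y \<partial>M)
        \<le> ennreal (h n) * ennreal (Kt * s n powr (1 - \<beta>))"
      using \<kappa>_nonneg by (intro mult_left_mono) auto
    also have "\<dots> = ennreal (Kt * (h n * s n powr (1 - \<beta>)))"
      using h[of n] Kt by (simp add: mult_ac flip: ennreal_mult)
    finally show ?thesis by (simp add: s_def h_eq)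
  qed
  have I3: "ennreal (h i) * (\<integral>\<^sup>+ y. ennreal (\<kappa> x y) * indicator {y. s i < \<kappa> x y} y \<partial>M) \<le> ennreal (Kt * e)"
    unfolding e_def by (rule T)
  have I4: "ennreal (s i) * (\<integral>\<^sup>+ y. ennreal (max (f y - h i) 0) \<partial>M) \<le> ennreal e"
    unfolding e_def s_def by (rule upper1)
  have I5: "ennreal (h (i + m)) * (\<integral>\<^sup>+ y. ennreal (\<kappa> x y) * indicator {y. s (i + m) < \<kappa> x y} y \<partial>M) \<le> ennreal (Kt * e)"
    by (rule order_trans[OF T]) (intro ennreal_leI mult_left_mono e_le Kt)
  have I6: "(\<integral>\<^sup>+ y. ennreal (\<kappa> x y * indicator {y. s (i + m) < \<kappa> x y} y * max (f y - h (i + m)) 0) \<partial>M) \<le> ennreal e"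
    unfolding s_def by (rule order_trans[OF rest]) (intro ennreal_leI e_le)
  have "(\<integral>\<^sup>+ y. ennreal (\<kappa> x y * f y) \<partial>M) \<le>
      ennreal ((A * \<beta> * real i + c) powr (1 / \<beta>) * (1 - \<epsilon> i) powr (1 / p))
    + ennreal ((A * \<beta> * real m + c) powr (1 / \<beta>) * e)
    + (ennreal (Kt * e) + ennreal e + ennreal (Kt * e) + ennreal e)"
    by (rule order_trans[OF two_level_split[OF f _ _ f0 _ _ s_mono, of "\<kappa> x" "h i" "h (i + m)"]])
      (use \<kappa>_nonneg h[of i] h[of "i + m"] in \<open>auto intro!: add_mono I1 I2 I3 I4 I5 I6 simp: less_imp_le\<close>)
  also have "\<dots> = ennreal ((A * \<beta> * real i + c) powr (1 / \<beta>) * (1 - \<epsilon> i) powr (1 / p)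
      + (A * \<beta> * real m + c) powr (1 / \<beta>) * e + (Kt * e + e + Kt * e + e))"
    using Kt e by (simp flip: ennreal_plus)
  also have "(A * \<beta> * real i + c) powr (1 / \<beta>) * (1 - \<epsilon> i) powr (1 / p)
      + (A * \<beta> * real m + c) powr (1 / \<beta>) * e + (Kt * e + e + Kt * e + e)
      = (A * \<beta> * real i + c) powr (1 / \<beta>) * (1 - \<epsilon> i) powr (1 / p)
      + ((A * \<beta> * real m + c) powr (1 / \<beta>) + (2 * Kt + 2)) * e"
    by (simp add: algebra_simps)
  finally show ?thesis by (simp add: Kt_def e_def)
qed

text \<open>Division by \<open>A * \<beta>\<close> produces the form required by
  \<open>Garsia_exponential_sum\<close>. The factor \<open>m + 1\<close> absorbs both constants
  \<open>c\<close> and \<open>D\<close>, also at \<open>m = 0\<close>.\<close>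

lemma two_level_bound_normalized:
  fixes q D :: real and i m :: nat
  assumes "0 \<le> q" "q \<le> 1" "0 \<le> D"
  shows "((A * \<beta> * real i + c) powr (1 / \<beta>) * (1 - q) powr (1 / p)
        + ((A * \<beta> * real m + c) powr (1 / \<beta>) + D) * q powr (1 / p)) powr \<beta> / (A * \<beta>)
    \<le> ((real i + c / (A * \<beta>)) powr (1 / \<beta>) * (1 - q) powr (1 / p)
        + ((A * \<beta> + c) powr (1 / \<beta>) + D) / (A * \<beta>) powr (1 / \<beta>) * (real m + 1) powr (1 / \<beta>) * q powr (1 / p)) powr \<beta>"
    (is "(?a1 * ?b1 + ?a2 * ?b2) powr \<beta> / _ \<le> _")
proof -
  have AB: "0 < A * \<beta>" using A \<beta> by simp
  define r where "r = (A * \<beta>) powr (1 / \<beta>)"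
  have r: "0 < r" "A * \<beta> = r powr \<beta>" using AB \<beta> by (auto simp: r_def powr_powr)
  have "?a2 \<le> (A * \<beta> + c) powr (1 / \<beta>) * (real m + 1) powr (1 / \<beta>) + D * (real m + 1) powr (1 / \<beta>)"
  proof (intro add_mono)
    have "A * \<beta> * real m + c \<le> (A * \<beta> + c) * (real m + 1)" using AB c by (simp add: algebra_simps)
    then show "(A * \<beta> * real m + c) powr (1 / \<beta>) \<le> (A * \<beta> + c) powr (1 / \<beta>) * (real m + 1) powr (1 / \<beta>)"
      unfolding powr_mult[symmetric] using AB c \<beta> by (intro powr_mono2) auto
    have "1 \<le> (real m + 1) powr (1 / \<beta>)" using \<beta> by (intro ge_one_powr_ge_zero) auto
    then show "D \<le> D * (real m + 1) powr (1 / \<beta>)" using assms by (simp add: mult_le_cancel_left1)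
  qed
  then have a2: "?a2 / r \<le> ((A * \<beta> + c) powr (1 / \<beta>) + D) / r * (real m + 1) powr (1 / \<beta>)"
    using r(1) by (simp add: divide_right_mono distrib_right)
  have a1: "?a1 / r = (real i + c / (A * \<beta>)) powr (1 / \<beta>)"
  proof -
    have "A * \<beta> * real i + c = A * \<beta> * (real i + c / (A * \<beta>))" using A \<beta> by (simp add: field_simps)
    then have "?a1 = r * (real i + c / (A * \<beta>)) powr (1 / \<beta>)" unfolding r_def by (simp only: powr_mult)
    then show ?thesis using r(1) by simp
  qed
  have "(?a1 * ?b1 + ?a2 * ?b2) powr \<beta> / (A * \<beta>) = ((?a1 * ?b1 + ?a2 * ?b2) / r) powr \<beta>"
    unfolding r(2) by (simp add: powr_divide)
  also have "(?a1 * ?b1 + ?a2 * ?b2) / r = ?a1 / r * ?b1 + ?a2 / r * ?b2"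
    by (simp only: add_divide_distrib[of "?a1 * ?b1" "?a2 * ?b2"] times_divide_eq_left)
  also have "\<dots> powr \<beta> \<le> (?a1 / r * ?b1 + ((A * \<beta> + c) powr (1 / \<beta>) + D) / r * (real m + 1) powr (1 / \<beta>) * ?b2) powr \<beta>"
    using \<beta> r assms a2 by (intro powr_mono2 add_left_mono mult_right_mono) auto
  finally show ?thesis unfolding a1 by (simp only: r_def)
qed

text \<open>\<open>tail_operator_small\<close> at height \<open>exp j\<close> supplies
  \<open>E j\<close>. Since the exception depends on \<open>i + m\<close> only, one set serves all
  splittings \<open>j = i + m\<close>; \<open>Y j\<close> is the least of their bounds, so
  \<open>Garsia_exponential_sum\<close> applies to it. \<open>K\<close> and \<open>C\<close> are
  fixed before \<open>f\<close>.\<close>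

lemma exceptional_sets:
  obtains K C where "0 \<le> K" "0 \<le> C"
    "\<And>f. \<lbrakk>f \<in> borel_measurable M; \<And>y. 0 \<le> f y; (\<integral>\<^sup>+ y. ennreal (f y powr p) \<partial>M) = 1\<rbrakk> \<Longrightarrow>
      \<exists>(Y :: nat \<Rightarrow> real) E.
        (\<forall>j. E j \<in> sets N \<and> emeasure N (E j) \<le> ennreal (K * exp (- \<beta>0 * real j))) \<and>
        (\<forall>j. \<forall>x\<in>space N - E j. (\<integral>\<^sup>+ y. ennreal (\<kappa> x y * f y) \<partial>M) < \<infinity> \<and>
          (\<forall>t\<ge>0. ennreal t \<le> (\<integral>\<^sup>+ y. ennreal (\<kappa> x y * f y) \<partial>M) \<longrightarrow> t powr \<beta> / (A * \<beta>) \<le> Y j)) \<and>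
        (\<forall>n. (\<Sum>j<n. exp (- \<beta>0 * (real j - Y j))) \<le> C)"
proof -
  obtain K where K: "0 \<le> K" and small: 
    "\<And>v \<epsilon> s. \<lbrakk>v \<in> borel_measurable M; \<And>y. 0 \<le> v y; 0 < \<epsilon>; 0 < s; (\<integral>\<^sup>+ y. ennreal (v y powr p) \<partial>M) \<le> ennreal \<epsilon>\<rbrakk>
      \<Longrightarrow> \<exists>E\<in>sets N. emeasure N E \<le> ennreal (K * s powr (- \<beta>0)) \<and>
        (\<forall>x\<in>space N - E. (\<integral>\<^sup>+ y. ennreal (\<kappa> x y * indicator {y. s < \<kappa> x y} y * v y) \<partial>M) \<le> ennreal (\<epsilon> powr (1 / p)))"
    using tail_operator_small by blast
  define D where "D = 2 * (K1 * (\<beta> / (\<beta> - 1))) + 2"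
  define D' where "D' = ((A * \<beta> + c) powr (1 / \<beta>) + D) / (A * \<beta>) powr (1 / \<beta>)"
  have D: "0 \<le> D" using K1 \<beta> by (simp add: D_def)
  have AB: "0 < A * \<beta>" using A \<beta> by simp
  have D': "0 \<le> D'" using D by (simp add: D'_def)
  have c': "0 \<le> c / (A * \<beta>)" using c AB by simp
  obtain C where C: "0 \<le> C" "\<And>q Y n. \<lbrakk>\<And>i::nat. 0 \<le> q i \<and> q i \<le> 1;
       \<And>i m. Y (i + m) \<le> ((real i + c / (A * \<beta>)) powr (1 / \<beta>) * (1 - q i) powr (1 / p)
                 + D' * (real m + 1) powr (1 / \<beta>) * q i powr (1 / p)) powr \<beta>\<rbrakk>
      \<Longrightarrow> (\<Sum>i<n. exp (- \<beta>0 * (real i - Y i))) \<le> C"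
    using Garsia_exponential_sum[OF \<beta> p c' D' \<beta>0] by blast
  show ?thesis
  proof (rule that[OF K C(1)])
    fix f assume f[measurable]: "f \<in> borel_measurable M" and f0: "\<And>y. 0 \<le> f y"
      and f1: "(\<integral>\<^sup>+ y. ennreal (f y powr p) \<partial>M) = 1"
    obtain \<epsilon> h :: "nat \<Rightarrow> real" where
      \<epsilon>: "\<And>n. 0 < \<epsilon> n" "\<And>n. \<epsilon> n \<le> 1" and h: "\<And>n. 0 < h n" and anti: "\<And>i n. i \<le> n \<Longrightarrow> \<epsilon> n \<le> \<epsilon> i"
      and h_eq: "\<And>n. h n * exp (real n) powr (1 - \<beta>) = \<epsilon> n powr (1 / p)"
      and lower: "\<And>n. (\<integral>\<^sup>+ y. ennreal (min (f y) (h n) powr p) \<partial>M) \<le> ennreal (1 - \<epsilon> n)"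
      and upper: "\<And>n. (\<integral>\<^sup>+ y. ennreal (max (f y - h n) 0 powr p) \<partial>M) \<le> ennreal (\<epsilon> n)"
      and upper1: "\<And>n. ennreal (exp (real n)) * (\<integral>\<^sup>+ y. ennreal (max (f y - h n) 0) \<partial>M) \<le> ennreal (\<epsilon> n powr (1 / p))"
      using truncation_levels[OF M.finite_measure_axioms f f0 f1 \<beta> p] by metis
    have "\<forall>j. \<exists>E. E \<in> sets N \<and> emeasure N E \<le> ennreal (K * exp (real j) powr (- \<beta>0)) \<and>
        (\<forall>x\<in>space N - E. (\<integral>\<^sup>+ y. ennreal (\<kappa> x y * indicator {y. exp (real j) < \<kappa> x y} y * max (f y - h j) 0) \<partial>M)
          \<le> ennreal (\<epsilon> j powr (1 / p)))"
    proof
      fix j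
      show "\<exists>E. E \<in> sets N \<and> emeasure N E \<le> ennreal (K * exp (real j) powr (- \<beta>0)) \<and>
        (\<forall>x\<in>space N - E. (\<integral>\<^sup>+ y. ennreal (\<kappa> x y * indicator {y. exp (real j) < \<kappa> x y} y * max (f y - h j) 0) \<partial>M)
          \<le> ennreal (\<epsilon> j powr (1 / p)))"
        using small[of "\<lambda>y. max (f y - h j) 0" "\<epsilon> j" "exp (real j)"] upper[of j] \<epsilon>(1)[of j] by auto
    qed
    from choice[OF this] obtain E where E: "\<And>j. E j \<in> sets N" "\<And>j. emeasure N (E j) \<le> ennreal (K * exp (real j) powr (- \<beta>0))"
      and rest: "\<And>j x. x \<in> space N - E j \<Longrightarrow>
        (\<integral>\<^sup>+ y. ennreal (\<kappa> x y * indicator {y. exp (real j) < \<kappa> x y} y * max (f y - h j) 0) \<partial>M) \<le> ennreal (\<epsilon> j powr (1 / p))"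
      by auto
    define B where "B = (\<lambda>i m. (A * \<beta> * real i + c) powr (1 / \<beta>) * (1 - \<epsilon> i) powr (1 / p)
        + ((A * \<beta> * real m + c) powr (1 / \<beta>) + D) * \<epsilon> i powr (1 / p))"
    have B0: "0 \<le> B i m" for i m using D by (simp add: B_def)
    have bound: "(\<integral>\<^sup>+ y. ennreal (\<kappa> x y * f y) \<partial>M) \<le> ennreal (B i m)" if "x \<in> space N - E (i + m)" for x i m
      unfolding B_def D_def using that
      by (intro two_level_bound[where h = h, OF f f0 \<epsilon> h anti h_eq lower upper upper1] rest) auto
    define Y where "Y = (\<lambda>j. Min ((\<lambda>i. B i (j - i) powr \<beta> / (A * \<beta>)) ` {..j}))"
    have "Y (i + m) \<le> ((real i + c / (A * \<beta>)) powr (1 / \<beta>) * (1 - \<epsilon> i) powr (1 / p)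
         + D' * (real m + 1) powr (1 / \<beta>) * \<epsilon> i powr (1 / p)) powr \<beta>" for i m
    proof -
      have "Y (i + m) \<le> B i (i + m - i) powr \<beta> / (A * \<beta>)" unfolding Y_def by (intro Min_le image_eqI[of _ _ i]) auto
      also have "\<dots> \<le> ((real i + c / (A * \<beta>)) powr (1 / \<beta>) * (1 - \<epsilon> i) powr (1 / p)
         + D' * (real m + 1) powr (1 / \<beta>) * \<epsilon> i powr (1 / p)) powr \<beta>"
        unfolding B_def D'_def using two_level_bound_normalized[of "\<epsilon> i" D i m] \<epsilon>[of i] D by (simp add: less_imp_le)
      finally show ?thesis .
    qed
    then have sum: "(\<Sum>i<n. exp (- \<beta>0 * (real i - Y i))) \<le> C" for n
      using \<epsilon> by (intro C(2)[of \<epsilon>]) (auto simp: less_imp_le)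
    have Y_ge: "t powr \<beta> / (A * \<beta>) \<le> Y j"
      if x: "x \<in> space N - E j" and t: "0 \<le> t" "ennreal t \<le> (\<integral>\<^sup>+ y. ennreal (\<kappa> x y * f y) \<partial>M)" for x j t
      unfolding Y_def
    proof (intro Min.boundedI)
      fix b assume "b \<in> (\<lambda>i. B i (j - i) powr \<beta> / (A * \<beta>)) ` {..j}"
      then obtain i where i: "i \<le> j" "b = B i (j - i) powr \<beta> / (A * \<beta>)" by auto
      have "ennreal t \<le> ennreal (B i (j - i))" using t(2) bound[of x i "j - i"] x i by auto
      then have "t \<le> B i (j - i)" using B0 by simp
      then show "t powr \<beta> / (A * \<beta>) \<le> b" unfolding i using t AB \<beta> by (intro divide_right_mono powr_mono2) auto
    qed auto
    have fin: "(\<integral>\<^sup>+ y. ennreal (\<kappa> x y * f y) \<partial>M) < \<infinity>" if "x \<in> space N - E j" for x j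
      using bound[of x j 0] that by (auto intro: le_less_trans)
    have "exp (real j) powr (- \<beta>0) = exp (- \<beta>0 * real j)" for j by (simp add: exp_powr_real mult.commute)
    then show "\<exists>(Y :: nat \<Rightarrow> real) E.
        (\<forall>j. E j \<in> sets N \<and> emeasure N (E j) \<le> ennreal (K * exp (- \<beta>0 * real j))) \<and>
        (\<forall>j. \<forall>x\<in>space N - E j. (\<integral>\<^sup>+ y. ennreal (\<kappa> x y * f y) \<partial>M) < \<infinity> \<and>
          (\<forall>t\<ge>0. ennreal t \<le> (\<integral>\<^sup>+ y. ennreal (\<kappa> x y * f y) \<partial>M) \<longrightarrow> t powr \<beta> / (A * \<beta>) \<le> Y j)) \<and>
        (\<forall>n. (\<Sum>j<n. exp (- \<beta>0 * (real j - Y j))) \<le> C)"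
      using E sum Y_ge fin by (intro exI[of _ Y] exI[of _ E]) auto
  qed
qed

section \<open>From the exceptional sets to the exponential integral\<close>

lemma AE_not_in_all_of_exp_decay:
  assumes E: "\<And>j::nat. E j \<in> sets N" "\<And>j. emeasure N (E j) \<le> ennreal (K * exp (- \<beta>0 * real j))"
  shows "AE x in N. \<exists>j. x \<notin> E j"
proof -
  have "(\<lambda>j::nat. exp (- \<beta>0) ^ j) \<longlonglongrightarrow> 0" using \<beta>0 by (intro LIMSEQ_power_zero) simp
  then have "(\<lambda>j. ennreal (K * exp (- \<beta>0) ^ j)) \<longlonglongrightarrow> ennreal (K * 0)"
    by (intro tendsto_ennrealI tendsto_mult_left)
  moreover have "emeasure N (\<Inter>j. E j) \<le> ennreal (K * exp (- \<beta>0) ^ j)" for j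
  proof -
    have "emeasure N (\<Inter>j. E j) \<le> emeasure N (E j)" using E(1) by (intro emeasure_mono) auto
    also have "\<dots> \<le> ennreal (K * exp (- \<beta>0 * real j))" by (rule E)
    finally show ?thesis by (simp add: mult.commute flip: exp_of_nat_mult)
  qed
  ultimately have "emeasure N (\<Inter>j. E j) \<le> ennreal (K * 0)" by (intro LIMSEQ_le_const) auto
  moreover have "(\<Inter>j. E j) \<in> sets N" using E(1) by auto
  ultimately have "(\<Inter>j. E j) \<in> null_sets N" by auto
  then have "AE x in N. x \<notin> (\<Inter>j. E j)" by (rule AE_not_in)
  then show ?thesis by simp
qed

text \<open>Almost every \<open>x\<close> leaves the sets \<open>E j\<close> at a first index
  \<open>j\<close>. There the integrand is at most \<open>exp (\<beta>0 * Y j)\<close>, and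
  \<open>x\<close> lies in \<open>E (j - 1)\<close> unless \<open>j = 0\<close>. Weighting by the
  measures of the sets leaves the exponential sum of \<open>exceptional_sets\<close>.\<close>

lemma exponential_integrability:
  obtains C where "0 \<le> C"
    "\<And>f. \<lbrakk>f \<in> borel_measurable M; \<And>y. 0 \<le> f y; (\<integral>\<^sup>+ y. ennreal (f y powr p) \<partial>M) = 1\<rbrakk> \<Longrightarrow>
      (AE x in N. (\<integral>\<^sup>+ y. ennreal (\<kappa> x y * f y) \<partial>M) < \<infinity>) \<and>
      (\<forall>t. (\<forall>x\<in>space N. 0 \<le> t x \<and> ennreal (t x) \<le> (\<integral>\<^sup>+ y. ennreal (\<kappa> x y * f y) \<partial>M)) \<longrightarrow>
        (\<integral>\<^sup>+ x. ennreal (exp (\<beta>0 / (A * \<beta>) * t x powr \<beta>)) \<partial>N) \<le> ennreal C)"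
proof -
  obtain K C where K: "0 \<le> K" and C: "0 \<le> C" and except:
    "\<And>f. \<lbrakk>f \<in> borel_measurable M; \<And>y. 0 \<le> f y; (\<integral>\<^sup>+ y. ennreal (f y powr p) \<partial>M) = 1\<rbrakk> \<Longrightarrow>
      \<exists>(Y :: nat \<Rightarrow> real) E.
        (\<forall>j. E j \<in> sets N \<and> emeasure N (E j) \<le> ennreal (K * exp (- \<beta>0 * real j))) \<and>
        (\<forall>j. \<forall>x\<in>space N - E j. (\<integral>\<^sup>+ y. ennreal (\<kappa> x y * f y) \<partial>M) < \<infinity> \<and>
          (\<forall>t\<ge>0. ennreal t \<le> (\<integral>\<^sup>+ y. ennreal (\<kappa> x y * f y) \<partial>M) \<longrightarrow> t powr \<beta> / (A * \<beta>) \<le> Y j)) \<and>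
        (\<forall>n. (\<Sum>j<n. exp (- \<beta>0 * (real j - Y j))) \<le> C)"
    using exceptional_sets by blast
  show ?thesis
  proof (rule that[of "C * measure N (space N) + K * exp \<beta>0 * C"])
    show "0 \<le> C * measure N (space N) + K * exp \<beta>0 * C" using K C by simp
    fix f assume "f \<in> borel_measurable M" "\<And>y. 0 \<le> f y" "(\<integral>\<^sup>+ y. ennreal (f y powr p) \<partial>M) = 1"
    from except[OF this] obtain Y :: "nat \<Rightarrow> real" and E where
      E: "\<And>j. E j \<in> sets N" "\<And>j. emeasure N (E j) \<le> ennreal (K * exp (- \<beta>0 * real j))"
      and fin: "\<And>j x. x \<in> space N - E j \<Longrightarrow> (\<integral>\<^sup>+ y. ennreal (\<kappa> x y * f y) \<partial>M) < \<infinity>"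
      and Y: "\<And>j x t. \<lbrakk>x \<in> space N - E j; 0 \<le> t; ennreal t \<le> (\<integral>\<^sup>+ y. ennreal (\<kappa> x y * f y) \<partial>M)\<rbrakk>
        \<Longrightarrow> t powr \<beta> / (A * \<beta>) \<le> Y j"
      and sum: "\<And>n. (\<Sum>j<n. exp (- \<beta>0 * (real j - Y j))) \<le> C"
      by blast
    have AE: "AE x in N. \<exists>j. x \<notin> E j" by (rule AE_not_in_all_of_exp_decay[OF E])
    have "(\<integral>\<^sup>+ x. ennreal (exp (\<beta>0 / (A * \<beta>) * t x powr \<beta>)) \<partial>N) \<le> ennreal (C * measure N (space N) + K * exp \<beta>0 * C)"
      if t: "\<forall>x\<in>space N. 0 \<le> t x \<and> ennreal (t x) \<le> (\<integral>\<^sup>+ y. ennreal (\<kappa> x y * f y) \<partial>M)" for t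
    proof -
      define a where "a = (\<lambda>j. exp (\<beta>0 * Y j))"
      have "AE x in N. ennreal (exp (\<beta>0 / (A * \<beta>) * t x powr \<beta>))
          \<le> ennreal (a 0) + (\<Sum>j. ennreal (a (Suc j)) * indicator (E j) x)"
        using AE AE_space
      proof eventually_elim
        case (elim x)
        define j where "j = (LEAST j. x \<notin> E j)"
        have j: "x \<notin> E j" using elim(1) unfolding j_def by (rule LeastI_ex)
        have "t x powr \<beta> / (A * \<beta>) \<le> Y j" using Y[of x j "t x"] t elim(2) j by auto
        then have "\<beta>0 * (t x powr \<beta> / (A * \<beta>)) \<le> \<beta>0 * Y j" using \<beta>0 by (intro mult_left_mono) auto
        then have "exp (\<beta>0 / (A * \<beta>) * t x powr \<beta>) \<le> a j" by (simp add: a_def)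
        then have "ennreal (exp (\<beta>0 / (A * \<beta>) * t x powr \<beta>)) \<le> ennreal (a j)" by (rule ennreal_leI)
        also have "\<dots> \<le> ennreal (a 0) + (\<Sum>j. ennreal (a (Suc j)) * indicator (E j) x)"
        proof (cases j)
          case (Suc i)
          have "x \<in> E i" using not_less_Least[of i "\<lambda>j. x \<notin> E j"] Suc by (auto simp: j_def)
          then have "ennreal (a j) = (\<Sum>j\<in>{i}. ennreal (a (Suc j)) * indicator (E j) x)" using Suc by simp
          also have "\<dots> \<le> (\<Sum>j. ennreal (a (Suc j)) * indicator (E j) x)" by (intro sum_le_suminf) auto
          finally show ?thesis by (simp add: add_increasing)
        qed simp
        finally show ?case .
      qed
      then have "(\<integral>\<^sup>+ x. ennreal (exp (\<beta>0 / (A * \<beta>) * t x powr \<beta>)) \<partial>N)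
          \<le> (\<integral>\<^sup>+ x. ennreal (a 0) + (\<Sum>j. ennreal (a (Suc j)) * indicator (E j) x) \<partial>N)"
        by (rule nn_integral_mono_AE)
      also have "\<dots> = ennreal (a 0) * emeasure N (space N) + (\<Sum>j. ennreal (a (Suc j)) * emeasure N (E j))"
        using E(1) by (simp add: nn_integral_add nn_integral_suminf nn_integral_cmult_indicator)
      also have "\<dots> \<le> ennreal (C * measure N (space N)) + ennreal (K * exp \<beta>0 * C)"
      proof (rule add_mono)
        \<comment> \<open>The exponential sum with a single term is
          \<open>exp (\<beta>0 * Y 0)\<close>.\<close>
        have "a 0 \<le> C" using sum[of 1] by (simp add: a_def)
        then show "ennreal (a 0) * emeasure N (space N) \<le> ennreal (C * measure N (space N))"
          unfolding N.emeasure_eq_measure using C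
          by (subst ennreal_mult) (auto intro!: mult_right_mono ennreal_leI)
        show "(\<Sum>j. ennreal (a (Suc j)) * emeasure N (E j)) \<le> ennreal (K * exp \<beta>0 * C)"
        proof (intro suminf_le_const)
          fix n
          have "(\<Sum>j<n. ennreal (a (Suc j)) * emeasure N (E j))
              \<le> (\<Sum>j<n. ennreal (K * exp \<beta>0 * exp (- \<beta>0 * (real (Suc j) - Y (Suc j)))))"
          proof (intro sum_mono)
            fix j
            have "ennreal (a (Suc j)) * emeasure N (E j) \<le> ennreal (a (Suc j)) * ennreal (K * exp (- \<beta>0 * real j))"
              by (intro mult_left_mono E) auto
            also have "\<dots> = ennreal (a (Suc j) * (K * exp (- \<beta>0 * real j)))"
              using K by (intro ennreal_mult[symmetric]) (auto simp: a_def)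
            \<comment> \<open>\<open>E j\<close> is paired with \<open>Y (Suc j)\<close>; the shift
              by one costs the factor \<open>exp \<beta>0\<close>.\<close>
            also have "a (Suc j) * (K * exp (- \<beta>0 * real j)) = K * exp \<beta>0 * exp (- \<beta>0 * (real (Suc j) - Y (Suc j)))"
              by (simp add: a_def algebra_simps flip: exp_add)
            finally show "ennreal (a (Suc j)) * emeasure N (E j) \<le> \<dots>" .
          qed
          also have "\<dots> = ennreal (K * exp \<beta>0 * (\<Sum>j<n. exp (- \<beta>0 * (real (Suc j) - Y (Suc j)))))"
            using K by (simp add: sum_distrib_left sum_ennreal)
          also have "\<dots> \<le> ennreal (K * exp \<beta>0 * C)"
          proof (intro ennreal_leI mult_left_mono)
            have "(\<Sum>j<n. exp (- \<beta>0 * (real (Suc j) - Y (Suc j)))) \<le> (\<Sum>j<Suc n. exp (- \<beta>0 * (real j - Y j)))"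
              by (subst sum.lessThan_Suc_shift) simp
            also have "\<dots> \<le> C" by (rule sum)
            finally show "(\<Sum>j<n. exp (- \<beta>0 * (real (Suc j) - Y (Suc j)))) \<le> C" .
          qed (use K in simp)
          finally show "(\<Sum>j<n. ennreal (a (Suc j)) * emeasure N (E j)) \<le> ennreal (K * exp \<beta>0 * C)" .
        qed simp
      qed
      also have "\<dots> = ennreal (C * measure N (space N) + K * exp \<beta>0 * C)"
        using C K by (simp flip: ennreal_plus)
      finally show ?thesis .
    qed
    moreover have "AE x in N. (\<integral>\<^sup>+ y. ennreal (\<kappa> x y * f y) \<partial>M) < \<infinity>"
      using AE AE_space by eventually_elim (use fin in auto)
    ultimately show "(AE x in N. (\<integral>\<^sup>+ y. ennreal (\<kappa> x y * f y) \<partial>M) < \<infinity>) \<and>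
      (\<forall>t. (\<forall>x\<in>space N. 0 \<le> t x \<and> ennreal (t x) \<le> (\<integral>\<^sup>+ y. ennreal (\<kappa> x y * f y) \<partial>M)) \<longrightarrow>
        (\<integral>\<^sup>+ x. ennreal (exp (\<beta>0 / (A * \<beta>) * t x powr \<beta>)) \<partial>N) \<le> ennreal (C * measure N (space N) + K * exp \<beta>0 * C))"
      by blast
  qed
qed

end

subsection \<open>Rearrangements and distribution functions\<close>

lemma rearr_nonneg: "0 \<le> rearr M f t"
  unfolding rearr_def by (intro Inf_greatest) auto

lemma rearr_antimono: "t \<le> t' \<Longrightarrow> rearr M f t' \<le> rearr M f t"
  unfolding rearr_def by (intro Inf_superset_mono) (auto intro: order_trans[OF _ ennreal_leI])

lemma rearr_ge:
  assumes [measurable]: "f \<in> borel_measurable M" and t: "ennreal t < distrib_fun M f s"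
  shows "ereal s \<le> rearr M f t"
  unfolding rearr_def
proof (intro Inf_greatest, clarsimp)
  fix r assume r: "distrib_fun M f r \<le> ennreal t"
  show "s \<le> r"
  proof (rule ccontr)
    assume "\<not> s \<le> r"
    then have "distrib_fun M f s \<le> distrib_fun M f r"
      unfolding distrib_fun_def
      by (intro emeasure_mono) (auto intro: order_less_trans[of "ereal r" "ereal s"])
    with r t show False by simp
  qed
qed

text \<open>For \<open>t\<close> below \<open>m = distrib_fun M (g i) s\<close> the rearrangement at
  \<open>t\<close> is at least \<open>s\<close>. So for \<open>r < s\<close> the interval from
  \<open>0\<close> to \<open>m\<close> lies in the superlevel set of the supremum at
  \<open>r\<close>, and \<open>m\<close> is at most its length. Because only \<open>\<ge> s\<close>
  is known, the bound at \<open>s\<close> itself is reached by letting \<open>r\<close> increase to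
  \<open>s\<close>, with \<open>\<phi>\<close> continuous there.\<close>

lemma distrib_fun_le_of_SUP_rearr:
  fixes g :: "'i \<Rightarrow> 'a \<Rightarrow> ereal" and \<phi> :: "real \<Rightarrow> real"
  assumes "finite_measure M" and meas: "g i \<in> borel_measurable M" and i: "i \<in> I"
    and s: "0 \<le> s0" "s0 < s" and cont: "isCont \<phi> s"
    and le: "\<And>r. s0 \<le> r \<Longrightarrow> distrib_fun lebesgue_pos (\<lambda>t. SUP i\<in>I. rearr M (g i) t) r \<le> ennreal (\<phi> r)"
  shows "distrib_fun M (g i) s \<le> ennreal (\<phi> s)"
proof -
  interpret finite_measure M by fact
  define k where "k = (\<lambda>t. SUP i\<in>I. rearr M (g i) t)"
  define m where "m = measure M {x \<in> space M. ereal s < \<bar>g i x\<bar>}"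
  have m: "distrib_fun M (g i) s = ennreal m"
    unfolding distrib_fun_def m_def by (rule emeasure_eq_measure)
  have k0: "0 \<le> k t" for t
    unfolding k_def by (rule order_trans[OF rearr_nonneg SUP_upper[OF i]])
  have kmono: "k t' \<le> k t" if "t \<le> t'" for t t'
    unfolding k_def using that by (intro SUP_mono') (rule rearr_antimono)
  have *: "ennreal m \<le> ennreal (\<phi> r)" if r: "s0 \<le> r" "r < s" for r
  proof -
    define S where "S = {t. 0 < t \<and> ereal r < k t}"
    \<comment> \<open>The supremum runs over an arbitrary index set, but it is nonincreasing in
      \<open>t\<close>; its superlevel sets are intervals and hence measurable.\<close>
    have "is_interval S"
      unfolding is_interval_1 S_def by (auto intro: less_le_trans kmono)
    then have S: "S \<in> sets borel" by (rule real_interval_borel_measurable)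
    have "{0<..<m} \<subseteq> S"
    proof
      fix t assume t: "t \<in> {0<..<m}"
      then have "ennreal t < distrib_fun M (g i) s" unfolding m by (simp add: ennreal_lessI)
      then have "ereal s \<le> rearr M (g i) t" by (rule rearr_ge[OF meas])
      also have "\<dots> \<le> k t" unfolding k_def using i by (rule SUP_upper)
      finally show "t \<in> S" using r t by (auto simp: S_def intro: less_le_trans[of _ "ereal s"])
    qed
    then have "emeasure lborel {0<..<m} \<le> emeasure lborel S" using S by (intro emeasure_mono) auto
    also have "emeasure lborel S = distrib_fun lebesgue_pos k r"
    proof -
      have "{x \<in> space lebesgue_pos. ereal r < \<bar>k x\<bar>} = S"
        using k0 by (auto simp: S_def lebesgue_pos_def space_restrict_space)
      then show ?thesis
        unfolding distrib_fun_def lebesgue_pos_def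
        by (subst emeasure_restrict_space) (auto simp: S_def lebesgue_pos_def)
    qed
    also have "\<dots> \<le> ennreal (\<phi> r)" unfolding k_def by (rule le[OF r(1)])
    finally show ?thesis by (simp add: m_def)
  qed
  have "((\<lambda>r. ennreal (\<phi> r)) \<longlongrightarrow> ennreal (\<phi> s)) (at_left s)"
    using cont by (intro tendsto_ennrealI) (auto simp: isCont_def intro: tendsto_mono[OF at_le])
  moreover have "\<forall>\<^sub>F r in at_left s. ennreal m \<le> ennreal (\<phi> r)"
    unfolding eventually_at_left_field using s(2) * by (intro exI[of _ s0]) auto
  ultimately show ?thesis unfolding m by (rule tendsto_lowerbound) simp
qed

text \<open>Below \<open>s1\<close> the total mass is the bound, enlarged by
  \<open>(s1 / r) powr b \<ge> 1\<close> to give it the required form.\<close>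

lemma tail_bound_extend:
  fixes g :: "'a \<Rightarrow> real"
  assumes "finite_measure M" and nn: "0 < s1" "0 \<le> L" "0 \<le> b"
    and tail: "\<And>r. s1 \<le> r \<Longrightarrow> emeasure M {y \<in> space M. r < g y} \<le> ennreal (L * r powr (- b))" and r: "0 < r"
  shows "emeasure M {y \<in> space M. r < g y} \<le> ennreal ((L + measure M (space M) * s1 powr b) * r powr (- b))"
proof -
  interpret finite_measure M by fact
  show ?thesis
  proof (cases "s1 \<le> r")
    case True
    then show ?thesis
      by (intro order_trans[OF tail] ennreal_leI mult_right_mono) auto
  next
    case False
    have "1 \<le> (s1 / r) powr b" using False r nn by (intro ge_one_powr_ge_zero) auto
    then have "measure M (space M) * 1 \<le> measure M (space M) * (s1 / r) powr b"
      by (intro mult_left_mono) auto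
    also have "\<dots> \<le> (L + measure M (space M) * s1 powr b) * r powr (- b)"
      using nn by (simp add: powr_divide powr_minus_divide divide_right_mono mult.commute)
    finally have "ennreal (measure M (space M)) \<le> ennreal ((L + measure M (space M) * s1 powr b) * r powr (- b))"
      by (simp add: ennreal_leI)
    moreover have "emeasure M {y \<in> space M. r < g y} \<le> emeasure M (space M)"
      by (rule emeasure_space)
    ultimately show ?thesis unfolding emeasure_eq_measure by (rule order_trans[rotated])
  qed
qed

section \<open>From logarithmic tail bounds to the kernel hypotheses\<close>

lemma powr_one_plus_log_le:
  fixes A C \<gamma> b r :: real
  assumes "0 \<le> A" "0 \<le> C" "0 \<le> \<gamma>" "exp 1 \<le> r"
  shows "A * r powr (- b) * (1 + C * ln r powr (- \<gamma>)) \<le> A * (1 + C) * r powr (- b)"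
proof -
  have "0 < r" using assms(4) by (rule less_le_trans[rotated]) simp
  then have "1 \<le> ln r" using assms(4) by (simp add: ln_ge_iff)
  then have "ln r powr (- \<gamma>) \<le> 1 powr (- \<gamma>)" using assms by (intro powr_mono2') auto
  then have "A * r powr (- b) * (1 + C * ln r powr (- \<gamma>)) \<le> A * r powr (- b) * (1 + C * 1)"
    using assms by (intro mult_left_mono add_left_mono) auto
  then show ?thesis by (simp add: mult_ac)
qed

text \<open>In the layer cake integral the leading part of the tail leaves
  \<open>A * \<beta> / r\<close>, which gives the sharp logarithm, and the correction leaves a
  multiple of \<open>ln r powr (- \<gamma>) / r\<close>, integrable up to infinity because
  \<open>\<gamma> > 1\<close>. The mass term is counted twice, once in the boundary term and once
  for the radii below \<open>s1\<close>.\<close>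

lemma log_band_bound:
  fixes g :: "'a \<Rightarrow> real" and A C \<beta> \<gamma> s1 :: real
  assumes M: "finite_measure M" and [measurable]: "g \<in> borel_measurable M"
    and \<beta>: "1 < \<beta>" and \<gamma>: "1 < \<gamma>" and A: "0 < A" and C: "0 \<le> C" and s1: "exp 1 \<le> s1"
    and tail: "\<And>r. s1 \<le> r \<Longrightarrow> emeasure M {y \<in> space M. r < g y} \<le> ennreal (A * r powr (- \<beta>) * (1 + C * ln r powr (- \<gamma>)))"
    and s: "1 \<le> s" "s \<le> t"
  shows "(\<integral>\<^sup>+ y. ennreal (g y powr \<beta>) * indicator {y. s < g y \<and> g y \<le> t} y \<partial>M)
    \<le> ennreal (A * \<beta> * ln (t / s) + (A * (1 + C) + 2 * (measure M (space M) * s1 powr \<beta>)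
        + A * \<beta> * C / (\<gamma> - 1) * ln s1 powr (1 - \<gamma>)))"
proof -
  interpret finite_measure M by fact
  define \<mu> where "\<mu> = measure M (space M)"
  have \<mu>: "0 \<le> \<mu>" by (simp add: \<mu>_def)
  have s1': "1 < s1" by (rule less_le_trans[OF _ s1]) simp
  \<comment> \<open>Below \<open>s1\<close>, outside the range of \<open>tail\<close>, the
    distribution function is bounded by the total mass.\<close>
  define \<psi> where "\<psi> = (\<lambda>r. if r < s1 then \<mu> else A * r powr (- \<beta>) * (1 + C * ln r powr (- \<gamma>)))"
  have [measurable]: "\<psi> \<in> borel_measurable borel" unfolding \<psi>_def by measurable
  have \<psi>: "emeasure M {y \<in> space M. r < g y} \<le> ennreal (\<psi> r)" for r
    using tail[of r] emeasure_space[of M "{y \<in> space M. r < g y}"]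
    by (auto simp: \<psi>_def \<mu>_def emeasure_eq_measure)
  have "(\<integral>\<^sup>+ y. ennreal (g y powr \<beta>) * indicator {y. s < g y \<and> g y \<le> t} y \<partial>M)
    \<le> ennreal (s powr \<beta>) * ennreal (\<psi> s)
      + (\<integral>\<^sup>+ r. ennreal (\<beta> * r powr (\<beta> - 1)) * ennreal (\<psi> r) * indicator ({..t} \<inter> {s..}) r \<partial>lborel)"
    by (rule nn_integral_powr_band_le[OF sigma_finite_measure_axioms]) (use s \<beta> in \<open>auto intro: \<psi>\<close>)
  also have "\<dots> \<le> ennreal (A * (1 + C) + \<mu> * s1 powr \<beta>) + (ennreal (A * \<beta> * ln t - A * \<beta> * ln s)
      + ennreal (\<mu> * s1 powr \<beta> - \<mu> * 1 powr \<beta>) + ennreal (0 - - (A * \<beta> * C / (\<gamma> - 1) * ln s1 powr (1 - \<gamma>))))"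
  proof (rule add_mono)
    have "s powr \<beta> * \<psi> s \<le> A * (1 + C) + \<mu> * s1 powr \<beta>"
    proof (cases "s < s1")
      case True
      have "s powr \<beta> \<le> s1 powr \<beta>" using True s \<beta> by (intro powr_mono2) auto
      then have "\<mu> * s powr \<beta> \<le> \<mu> * s1 powr \<beta>" using \<mu> by (rule mult_left_mono)
      moreover have "0 \<le> A * (1 + C)" using A C by simp
      ultimately show ?thesis using True by (simp add: \<psi>_def mult.commute)
    next
      case False
      have "s powr \<beta> * \<psi> s \<le> s powr \<beta> * (A * (1 + C) * s powr (- \<beta>))"
        using False powr_one_plus_log_le[of A C \<gamma> s \<beta>] A C \<gamma> s1 by (intro mult_left_mono) (auto simp: \<psi>_def)
      also have "\<dots> = A * (1 + C)" using s by (simp add: powr_minus field_simps)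
      finally show ?thesis using \<mu> by (simp add: add_increasing2)
    qed
    then show "ennreal (s powr \<beta>) * ennreal (\<psi> s) \<le> ennreal (A * (1 + C) + \<mu> * s1 powr \<beta>)"
      by (simp add: ennreal_leI flip: ennreal_mult')
    \<comment> \<open>The errors are integrated over \<open>{1..s1}\<close> and
      \<open>{s1..}\<close>, which do not depend on \<open>s\<close> and \<open>t\<close>; only the
      leading term keeps the range \<open>{s..t}\<close>.\<close>
    have "(\<integral>\<^sup>+ r. ennreal (\<beta> * r powr (\<beta> - 1)) * ennreal (\<psi> r) * indicator ({..t} \<inter> {s..}) r \<partial>lborel)
      \<le> (\<integral>\<^sup>+ r. ennreal (A * \<beta> / r) * indicator {s..t} r + ennreal (\<mu> * (\<beta> * r powr (\<beta> - 1))) * indicator {1..s1} r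
        + ennreal (A * \<beta> * C * ln r powr (- \<gamma>) / r) * indicator {s1..} r \<partial>lborel)"
    proof (rule nn_integral_mono)
      fix r
      show "ennreal (\<beta> * r powr (\<beta> - 1)) * ennreal (\<psi> r) * indicator ({..t} \<inter> {s..}) r
        \<le> ennreal (A * \<beta> / r) * indicator {s..t} r + ennreal (\<mu> * (\<beta> * r powr (\<beta> - 1))) * indicator {1..s1} r
        + ennreal (A * \<beta> * C * ln r powr (- \<gamma>) / r) * indicator {s1..} r"
      proof (cases "s \<le> r \<and> r \<le> t")
        case True
        then have r: "1 \<le> r" using s by auto
        show ?thesis
        proof (cases "r < s1")
          case True
          then show ?thesis using r \<open>s \<le> r \<and> r \<le> t\<close> \<beta> \<mu>
            by (simp add: \<psi>_def mult.commute add_increasing flip: ennreal_mult)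
        next
          case False
          have *: "r powr (\<beta> - 1) * r powr (- \<beta>) = 1 / r"
            unfolding powr_add[symmetric] using r by (simp add: powr_minus_divide)
          have "\<beta> * r powr (\<beta> - 1) * \<psi> r
              = (r powr (\<beta> - 1) * r powr (- \<beta>)) * (A * \<beta> * (1 + C * ln r powr (- \<gamma>)))"
            using False by (simp add: \<psi>_def)
          also have "\<dots> = A * \<beta> / r + A * \<beta> * C * ln r powr (- \<gamma>) / r"
            unfolding * by (simp add: algebra_simps add_divide_distrib)
          finally have "ennreal (\<beta> * r powr (\<beta> - 1)) * ennreal (\<psi> r) = ennreal (A * \<beta> / r) + ennreal (A * \<beta> * C * ln r powr (- \<gamma>) / r)"
            using r \<beta> A C by (simp flip: ennreal_mult' ennreal_plus)
          then show ?thesis using False \<open>s \<le> r \<and> r \<le> t\<close> by (simp add: add_increasing2 add_ac)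
        qed
      qed auto
    qed
    also have "\<dots> = (\<integral>\<^sup>+ r. ennreal (A * \<beta> / r) * indicator {s..t} r \<partial>lborel)
        + (\<integral>\<^sup>+ r. ennreal (\<mu> * (\<beta> * r powr (\<beta> - 1))) * indicator {1..s1} r \<partial>lborel)
        + (\<integral>\<^sup>+ r. ennreal (A * \<beta> * C * ln r powr (- \<gamma>) / r) * indicator {s1..} r \<partial>lborel)"
      by (simp add: nn_integral_add)
    also have "(\<integral>\<^sup>+ r. ennreal (A * \<beta> / r) * indicator {s..t} r \<partial>lborel) = ennreal (A * \<beta> * ln t - A * \<beta> * ln s)"
      by (rule nn_integral_FTC_Icc[where F = "\<lambda>r. A * \<beta> * ln r"])
        (use s A \<beta> in \<open>auto intro!: derivative_eq_intros\<close>)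
    also have "(\<integral>\<^sup>+ r. ennreal (\<mu> * (\<beta> * r powr (\<beta> - 1))) * indicator {1..s1} r \<partial>lborel) = ennreal (\<mu> * s1 powr \<beta> - \<mu> * 1 powr \<beta>)"
      by (rule nn_integral_FTC_Icc[where F = "\<lambda>r. \<mu> * r powr \<beta>"])
        (use s1' \<mu> \<beta> in \<open>auto intro!: derivative_eq_intros\<close>)
    also have "(\<integral>\<^sup>+ r. ennreal (A * \<beta> * C * ln r powr (- \<gamma>) / r) * indicator {s1..} r \<partial>lborel)
        = ennreal (0 - - (A * \<beta> * C / (\<gamma> - 1) * ln s1 powr (1 - \<gamma>)))"
    proof (rule nn_integral_FTC_atLeast)
      fix r assume r: "s1 \<le> r"
      then have "((\<lambda>r. ln r powr (1 - \<gamma>)) has_real_derivative (1 - \<gamma>) * ln r powr (1 - \<gamma> - 1) * (1 / r)) (at r)"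
        using s1'
        by (intro DERIV_chain2[where f = "\<lambda>z. z powr (1 - \<gamma>)"] has_real_derivative_powr DERIV_ln_divide) auto
      then have "((\<lambda>r. - (A * \<beta> * C / (\<gamma> - 1)) * ln r powr (1 - \<gamma>)) has_real_derivative
          - (A * \<beta> * C / (\<gamma> - 1)) * ((1 - \<gamma>) * ln r powr (1 - \<gamma> - 1) * (1 / r))) (at r)"
        by (rule DERIV_cmult)
      moreover have "- (A * \<beta> * C / (\<gamma> - 1)) * ((1 - \<gamma>) * ln r powr (1 - \<gamma> - 1) * (1 / r)) = A * \<beta> * C * ln r powr (- \<gamma>) / r"
        using \<gamma> r s1' by (simp add: field_simps)
      ultimately show "((\<lambda>r. - (A * \<beta> * C / (\<gamma> - 1) * ln r powr (1 - \<gamma>))) has_real_derivative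
          A * \<beta> * C * ln r powr (- \<gamma>) / r) (at r)" by simp
      show "0 \<le> A * \<beta> * C * ln r powr (- \<gamma>) / r" using A C \<beta> r s1' by simp
    next
      have "((\<lambda>r. ln r powr (1 - \<gamma>)) \<longlongrightarrow> 0) at_top"
        using \<gamma> by (intro tendsto_neg_powr ln_at_top) auto
      then have "((\<lambda>r. - (A * \<beta> * C / (\<gamma> - 1) * ln r powr (1 - \<gamma>))) \<longlongrightarrow> - (A * \<beta> * C / (\<gamma> - 1) * 0)) at_top"
        by (intro tendsto_intros)
      then show "((\<lambda>r. - (A * \<beta> * C / (\<gamma> - 1) * ln r powr (1 - \<gamma>))) \<longlongrightarrow> 0) at_top" by simp
    qed measurable
    finally show "(\<integral>\<^sup>+ r. ennreal (\<beta> * r powr (\<beta> - 1)) * ennreal (\<psi> r) * indicator ({..t} \<inter> {s..}) r \<partial>lborel)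
      \<le> ennreal (A * \<beta> * ln t - A * \<beta> * ln s) + ennreal (\<mu> * s1 powr \<beta> - \<mu> * 1 powr \<beta>)
        + ennreal (0 - - (A * \<beta> * C / (\<gamma> - 1) * ln s1 powr (1 - \<gamma>)))" .
  qed
  also have "\<dots> \<le> ennreal (A * (1 + C) + \<mu> * s1 powr \<beta>) + (ennreal (A * \<beta> * ln (t / s))
      + ennreal (\<mu> * s1 powr \<beta>) + ennreal (A * \<beta> * C / (\<gamma> - 1) * ln s1 powr (1 - \<gamma>)))"
    using s \<mu> by (intro add_mono ennreal_leI) (auto simp: ln_div algebra_simps)
  also have "\<dots> = ennreal (A * (1 + C) + \<mu> * s1 powr \<beta> + (A * \<beta> * ln (t / s)
      + \<mu> * s1 powr \<beta> + A * \<beta> * C / (\<gamma> - 1) * ln s1 powr (1 - \<gamma>)))"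
  proof -
    have "0 \<le> A * (1 + C) + \<mu> * s1 powr \<beta>" "0 \<le> A * \<beta> * ln (t / s)" "0 \<le> \<mu> * s1 powr \<beta>"
      "0 \<le> A * \<beta> * C / (\<gamma> - 1) * ln s1 powr (1 - \<gamma>)"
      using A C \<beta> \<gamma> \<mu> s by auto
    then show ?thesis by (simp flip: ennreal_plus)
  qed
  finally show ?thesis by (simp add: \<mu>_def algebra_simps)
qed

lemma Adams_kernel_of_log_tail:
  fixes M :: "'m measure" and N :: "'n measure" and \<kappa> :: "'n \<Rightarrow> 'm \<Rightarrow> real"
  assumes M: "finite_measure M" and N: "finite_measure N"
    and \<kappa>: "(\<lambda>(x, y). \<kappa> x y) \<in> borel_measurable (N \<Otimes>\<^sub>M M)" "\<And>x y. 0 \<le> \<kappa> x y"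
    and \<beta>: "1 < \<beta>" and p: "1 / \<beta> + 1 / p = 1" and \<beta>0: "0 < \<beta>0"
    and A: "0 < A" and B: "0 < B" and \<gamma>: "1 < \<gamma>" and C: "0 \<le> C" and s1: "exp 1 \<le> s1"
    and tail1: "\<And>x r. \<lbrakk>x \<in> space N; s1 \<le> r\<rbrakk> \<Longrightarrow>
      emeasure M {y \<in> space M. r < \<kappa> x y} \<le> ennreal (A * r powr (- \<beta>) * (1 + C * ln r powr (- \<gamma>)))"
    and tail2: "\<And>y r. \<lbrakk>y \<in> space M; s1 \<le> r\<rbrakk> \<Longrightarrow>
      emeasure N {x \<in> space N. r < \<kappa> x y} \<le> ennreal (B * r powr (- \<beta>0))"
  shows "\<exists>c K1 K2. Adams_kernel M N \<kappa> \<beta> p \<beta>0 A c K1 K2"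
proof -
  interpret M: finite_measure M by fact
  interpret N: finite_measure N by fact
  have s10: "0 < s1" by (rule less_le_trans[OF _ s1]) simp
  define c0 where "c0 = A * (1 + C) + 2 * (measure M (space M) * s1 powr \<beta>)
        + A * \<beta> * C / (\<gamma> - 1) * ln s1 powr (1 - \<gamma>)"
  have c0: "0 \<le> c0" using A C \<beta> \<gamma> by (simp add: c0_def)
  have [measurable]: "(\<lambda>y. \<kappa> x y) \<in> borel_measurable M" if "x \<in> space N" for x
    using measurable_compose[OF measurable_Pair1'[OF that] \<kappa>(1)] by simp
  have band: "(\<integral>\<^sup>+ y. ennreal (\<kappa> x y powr \<beta>) * indicator {y. s < \<kappa> x y \<and> \<kappa> x y \<le> t} y \<partial>M)
      \<le> ennreal (A * \<beta> * ln (t / s) + c0)" if "x \<in> space N" "1 \<le> s" "s \<le> t" for x s t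
    unfolding c0_def using that by (intro log_band_bound[OF M _ \<beta> \<gamma> A C s1 tail1]) auto
  \<comment> \<open>\<open>low\<close> is the band from \<open>1\<close> to \<open>s\<close> plus
    the part with \<open>\<kappa> \<le> 1\<close>, which adds at most the total mass; this is the
    second summand of the constant in place of \<open>c\<close>.\<close>
  have "Adams_kernel M N \<kappa> \<beta> p \<beta>0 A (c0 + measure M (space M))
      (A * (1 + C) + measure M (space M) * s1 powr \<beta>) (B + measure N (space N) * s1 powr \<beta>0)"
  proof
    fix x r assume x: "x \<in> space N" and r: "0 < (r::real)"
    show "emeasure M {y \<in> space M. r < \<kappa> x y} \<le> ennreal ((A * (1 + C) + measure M (space M) * s1 powr \<beta>) * r powr (- \<beta>))"
    proof (rule tail_bound_extend[OF M s10 _ _ _ r])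
      fix r assume r: "s1 \<le> r"
      show "emeasure M {y \<in> space M. r < \<kappa> x y} \<le> ennreal (A * (1 + C) * r powr (- \<beta>))"
        by (rule order_trans[OF tail1[OF x r]]) (intro ennreal_leI powr_one_plus_log_le, use A C \<gamma> s1 r in auto)
    qed (use A C \<beta> in auto)
  next
    fix y r assume y: "y \<in> space M" and r: "0 < (r::real)"
    show "emeasure N {x \<in> space N. r < \<kappa> x y} \<le> ennreal ((B + measure N (space N) * s1 powr \<beta>0) * r powr (- \<beta>0))"
      by (rule tail_bound_extend[OF N s10 _ _ _ r]) (use B \<beta>0 tail2[OF y] in auto)
  next
    fix x s assume x: "x \<in> space N" and s: "1 \<le> (s::real)"
    note x[measurable]
    have "(\<integral>\<^sup>+ y. ennreal (\<kappa> x y powr \<beta>) * indicator {y. \<kappa> x y \<le> s} y \<partial>M)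
        \<le> (\<integral>\<^sup>+ y. ennreal (\<kappa> x y powr \<beta>) * indicator {y. 1 < \<kappa> x y \<and> \<kappa> x y \<le> s} y + 1 \<partial>M)"
    proof (rule nn_integral_mono)
      fix y
      have "\<kappa> x y powr \<beta> \<le> 1" if "\<kappa> x y \<le> 1" using that \<kappa>(2) \<beta> by (intro powr_le1) auto
      then show "ennreal (\<kappa> x y powr \<beta>) * indicator {y. \<kappa> x y \<le> s} y
        \<le> ennreal (\<kappa> x y powr \<beta>) * indicator {y. 1 < \<kappa> x y \<and> \<kappa> x y \<le> s} y + 1"
        by (auto simp: indicator_def add_increasing2)
    qed
    also have "\<dots> = (\<integral>\<^sup>+ y. ennreal (\<kappa> x y powr \<beta>) * indicator {y. 1 < \<kappa> x y \<and> \<kappa> x y \<le> s} y \<partial>M) + ennreal (measure M (space M))"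
      by (simp add: nn_integral_add M.emeasure_eq_measure)
    also have "\<dots> \<le> ennreal (A * \<beta> * ln (s / 1) + c0) + ennreal (measure M (space M))"
      by (intro add_right_mono band x s) simp
    also have "\<dots> = ennreal (A * \<beta> * ln s + (c0 + measure M (space M)))"
      using A \<beta> s c0 by (simp add: add_ac flip: ennreal_plus)
    finally show "(\<integral>\<^sup>+ y. ennreal (\<kappa> x y powr \<beta>) * indicator {y. \<kappa> x y \<le> s} y \<partial>M)
        \<le> ennreal (A * \<beta> * ln s + (c0 + measure M (space M)))" .
  next
    fix x s t assume "x \<in> space N" "1 \<le> (s::real)" "s \<le> t"
    then show "(\<integral>\<^sup>+ y. ennreal (\<kappa> x y powr \<beta>) * indicator {y. s < \<kappa> x y \<and> \<kappa> x y \<le> t} y \<partial>M)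
      \<le> ennreal (A * \<beta> * ln (t / s) + (c0 + measure M (space M)))"
      by (intro order_trans[OF band] ennreal_leI) auto
  qed (use \<kappa> \<beta> p \<beta>0 A B C c0 in auto)
  then show ?thesis by blast
qed

subsection \<open>The exponential inequality\<close>

theorem theorem1:
  fixes M :: "'m measure" and N :: "'n measure" and k :: "'n \<Rightarrow> 'm \<Rightarrow> ereal"
    and A B \<beta> \<gamma> \<beta>0 :: real
  assumes "finite_measure M" and "finite_measure N"
    and "(\<lambda>(x, y). k x y) \<in> borel_measurable (N \<Otimes>\<^sub>M M)"
    and "A > 0" and "B > 0" and "\<beta> > 1" and "\<gamma> > 1" and "0 < \<beta>0" and "\<beta>0 \<le> \<beta>"
    and "\<exists>C0. \<forall>\<^sub>F s in at_top.
           distrib_fun lebesgue_pos (kstar1 N M k) s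
             \<le> ennreal (A * s powr (-\<beta>) * (1 + C0 * ln s powr (-\<gamma>)))"
    and "\<forall>\<^sub>F s in at_top. distrib_fun lebesgue_pos (kstar2 N M k) s \<le> ennreal (B * s powr (-\<beta>0))"
  shows "(\<forall>f. in_Lp M (\<beta> / (\<beta> - 1)) f \<longrightarrow>
            (AE x in N. (\<integral>\<^sup>+ y. e2ennreal \<bar>k x y * ereal (f y)\<bar> \<partial>M) < \<infinity>))
       \<and> (\<exists>C. \<forall>f. in_Lp M (\<beta> / (\<beta> - 1)) f \<and> Lp_norm M (\<beta> / (\<beta> - 1)) f \<noteq> 0 \<longrightarrow>
            (\<integral>\<^sup>+ x. ennreal (exp ((\<beta>0 / (A * \<beta>)) *
                 (\<bar>intop M k f x\<bar> / Lp_norm M (\<beta> / (\<beta> - 1)) f) powr \<beta>)) \<partial>N)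
              \<le> ennreal C)"
proof -
  note M = assms(1) and N = assms(2) and k = assms(3) and A = assms(4) and B = assms(5)
    and \<beta> = assms(6) and \<gamma> = assms(7) and \<beta>0 = assms(8)
  interpret M: finite_measure M by fact
  interpret N: finite_measure N by fact
  define p where "p = \<beta> / (\<beta> - 1)"
  have p: "1 / \<beta> + 1 / p = 1" and p1: "1 < p" using \<beta> by (auto simp: p_def field_simps)
  have [measurable]: "(\<lambda>y. k x y) \<in> borel_measurable M" if "x \<in> space N" for x
    using measurable_compose[OF measurable_Pair1'[OF that] k] by simp
  have [measurable]: "(\<lambda>x. k x y) \<in> borel_measurable N" if "y \<in> space M" for y
    using measurable_compose[OF measurable_Pair2'[OF that] k] by simp
  obtain C0 a b where
    ks1: "\<And>s. a \<le> s \<Longrightarrow> distrib_fun lebesgue_pos (kstar1 N M k) s \<le> ennreal (A * s powr (-\<beta>) * (1 + C0 * ln s powr (-\<gamma>)))"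
    and ks2: "\<And>s. b \<le> s \<Longrightarrow> distrib_fun lebesgue_pos (kstar2 N M k) s \<le> ennreal (B * s powr (-\<beta>0))"
    using assms(10,11) unfolding eventually_at_top_linorder by blast
  \<comment> \<open>\<open>exp 1\<close> ensures \<open>ln r \<ge> 1\<close>. Passing to
    \<open>s1 = s0 + 1\<close> leaves room on the left of \<open>r\<close>, since the bounds for
    sections arise as limits from below.\<close>
  define s0 where "s0 = max (exp 1) (max a b)"
  define s1 where "s1 = s0 + 1"
  \<comment> \<open>\<open>C0\<close> may be negative, while the integral estimates require a
    nonnegative constant.\<close>
  define C where "C = max C0 0"
  have s0: "a \<le> s0" "b \<le> s0" "exp 1 \<le> s0" by (auto simp: s0_def)
  have s00: "1 < s0" by (rule less_le_trans[OF _ s0(3)]) simp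
  have s1: "exp 1 \<le> s1" using s0 by (simp add: s1_def)
  have d1: "distrib_fun M (k x) r \<le> ennreal (A * r powr (-\<beta>) * (1 + C * ln r powr (-\<gamma>)))"
    if x: "x \<in> space N" and r: "s1 \<le> r" for x r
  proof -
    have r1: "s0 < r" "1 < r" using r s00 by (auto simp: s1_def)
    have "distrib_fun M (k x) r \<le> ennreal (A * r powr (-\<beta>) * (1 + C0 * ln r powr (-\<gamma>)))"
    proof (rule distrib_fun_le_of_SUP_rearr[where I = "space N" and ?s0.0 = s0, OF M _ x _ r1(1)])
      show "isCont (\<lambda>r. A * r powr - \<beta> * (1 + C0 * ln r powr - \<gamma>)) r"
        using r1 by (intro continuous_intros) auto
      show "distrib_fun lebesgue_pos (\<lambda>t. SUP i\<in>space N. rearr M (k i) t) r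
          \<le> ennreal (A * r powr - \<beta> * (1 + C0 * ln r powr - \<gamma>))" if "s0 \<le> r" for r
        using ks1[of r] that s0 unfolding kstar1_def by simp
    qed (use x s00 in auto)
    also have "\<dots> \<le> ennreal (A * r powr (-\<beta>) * (1 + C * ln r powr (-\<gamma>)))"
      using A by (intro ennreal_leI mult_left_mono add_left_mono mult_right_mono) (auto simp: C_def)
    finally show ?thesis .
  qed
  have d2: "distrib_fun N (\<lambda>x. k x y) r \<le> ennreal (B * r powr (-\<beta>0))"
    if y: "y \<in> space M" and r: "s1 \<le> r" for y r
  proof -
    have r1: "s0 < r" "1 < r" using r s00 by (auto simp: s1_def)
    show ?thesis
    proof (rule distrib_fun_le_of_SUP_rearr[where I = "space M" and ?s0.0 = s0 and g = "\<lambda>y x. k x y", OF N _ y _ r1(1)])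
      show "isCont (\<lambda>r. B * r powr - \<beta>0) r"
        using r1 by (intro continuous_intros) auto
      show "distrib_fun lebesgue_pos (\<lambda>t. SUP y\<in>space M. rearr N (\<lambda>x. k x y) t) r \<le> ennreal (B * r powr - \<beta>0)"
        if "s0 \<le> r" for r
        using ks2[of r] that s0 unfolding kstar2_def by simp
    qed (use y s00 in auto)
  qed
  \<comment> \<open>\<open>real_of_ereal\<close> sends infinite values to \<open>0\<close>, so
    \<open>\<kappa> \<le> \<bar>k\<bar>\<close> and the tail bounds persist. By
    \<open>finite_k\<close> below, equality holds almost everywhere on each section in
    \<open>x\<close>.\<close>
  define \<kappa> where "\<kappa> = (\<lambda>x y. real_of_ereal \<bar>k x y\<bar>)"
  have \<kappa>0: "0 \<le> \<kappa> x y" for x y by (simp add: \<kappa>_def real_of_ereal_pos)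
  have \<kappa>m: "(\<lambda>(x, y). \<kappa> x y) \<in> borel_measurable (N \<Otimes>\<^sub>M M)"
  proof -
    have "(\<lambda>z. real_of_ereal \<bar>(\<lambda>(x, y). k x y) z\<bar>) \<in> borel_measurable (N \<Otimes>\<^sub>M M)" using k by measurable
    then show ?thesis by (simp add: \<kappa>_def case_prod_unfold)
  qed
  have \<kappa>_less: "ereal r < \<bar>k x y\<bar>" if "0 \<le> r" "r < \<kappa> x y" for x y r
    using that by (cases "k x y") (auto simp: \<kappa>_def)
  have \<kappa>_tail1: "emeasure M {y \<in> space M. r < \<kappa> x y} \<le> ennreal (A * r powr (- \<beta>) * (1 + C * ln r powr (- \<gamma>)))"
    if "x \<in> space N" "s1 \<le> r" for x r
  proof -
    have r: "0 \<le> r" using that s00 by (simp add: s1_def)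
    have "emeasure M {y \<in> space M. r < \<kappa> x y} \<le> distrib_fun M (k x) r"
      unfolding distrib_fun_def using that \<kappa>_less[OF r] by (intro emeasure_mono) auto
    then show ?thesis using d1[OF that] by (rule order_trans)
  qed
  have \<kappa>_tail2: "emeasure N {x \<in> space N. r < \<kappa> x y} \<le> ennreal (B * r powr (- \<beta>0))"
    if "y \<in> space M" "s1 \<le> r" for y r
  proof -
    have r: "0 \<le> r" using that s00 by (simp add: s1_def)
    have "emeasure N {x \<in> space N. r < \<kappa> x y} \<le> distrib_fun N (\<lambda>x. k x y) r"
      unfolding distrib_fun_def using that \<kappa>_less[OF r] by (intro emeasure_mono) auto
    then show ?thesis using d2[OF that] by (rule order_trans)
  qed
  have C: "0 \<le> C" by (simp add: C_def)
  obtain c K1 K2 where "Adams_kernel M N \<kappa> \<beta> p \<beta>0 A c K1 K2"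
    using Adams_kernel_of_log_tail[OF M N \<kappa>m \<kappa>0 \<beta> p \<beta>0 A B \<gamma> C s1 \<kappa>_tail1 \<kappa>_tail2] by blast
  then interpret K: Adams_kernel M N \<kappa> \<beta> p \<beta>0 A c K1 K2 .
  obtain C1 where C1: "\<And>f. \<lbrakk>f \<in> borel_measurable M; \<And>y. 0 \<le> f y; (\<integral>\<^sup>+ y. ennreal (f y powr p) \<partial>M) = 1\<rbrakk> \<Longrightarrow>
      (AE x in N. (\<integral>\<^sup>+ y. ennreal (\<kappa> x y * f y) \<partial>M) < \<infinity>) \<and>
      (\<forall>t. (\<forall>x\<in>space N. 0 \<le> t x \<and> ennreal (t x) \<le> (\<integral>\<^sup>+ y. ennreal (\<kappa> x y * f y) \<partial>M)) \<longrightarrow>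
        (\<integral>\<^sup>+ x. ennreal (exp (\<beta>0 / (A * \<beta>) * t x powr \<beta>)) \<partial>N) \<le> ennreal C1)"
    using K.exponential_integrability by blast
  \<comment> \<open>The points where the section is infinite lie in all its superlevel sets, whose
    measures are bounded by a quantity tending to \<open>0\<close>.\<close>
  have finite_k: "AE y in M. \<bar>k x y\<bar> \<noteq> \<infinity>" if x: "x \<in> space N" for x
  proof -
    define Z where "Z = {y \<in> space M. \<bar>k x y\<bar> = \<infinity>}"
    have Z: "Z \<in> sets M" unfolding Z_def using x by measurable
    have "((\<lambda>r. A * (1 + C) * r powr (- \<beta>)) \<longlongrightarrow> A * (1 + C) * 0) at_top"
      using \<beta> by (intro tendsto_mult_left tendsto_neg_powr filterlim_ident) auto
    then have "((\<lambda>r. ennreal (A * (1 + C) * r powr (- \<beta>))) \<longlongrightarrow> ennreal (A * (1 + C) * 0)) at_top"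
      by (rule tendsto_ennrealI)
    moreover have "\<forall>\<^sub>F r in at_top. emeasure M Z \<le> ennreal (A * (1 + C) * r powr (- \<beta>))"
      using eventually_ge_at_top[of s1]
    proof eventually_elim
      case (elim r)
      have "emeasure M Z \<le> distrib_fun M (k x) r"
        unfolding distrib_fun_def Z_def using x by (intro emeasure_mono) auto
      also have "\<dots> \<le> ennreal (A * r powr (-\<beta>) * (1 + C * ln r powr (-\<gamma>)))" by (rule d1[OF x elim])
      also have "\<dots> \<le> ennreal (A * (1 + C) * r powr (- \<beta>))"
        by (intro ennreal_leI powr_one_plus_log_le) (use A C \<gamma> s1 elim in auto)
      finally show ?case .
    qed
    ultimately have "emeasure M Z \<le> ennreal (A * (1 + C) * 0)" by (rule tendsto_lowerbound) simp
    then have "Z \<in> null_sets M" using Z by auto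
    from AE_not_in[OF this] AE_space show ?thesis by eventually_elim (auto simp: Z_def)
  qed
  have abs_kf: "(\<integral>\<^sup>+ y. e2ennreal \<bar>k x y * ereal (f y)\<bar> \<partial>M) = (\<integral>\<^sup>+ y. ennreal (\<kappa> x y * \<bar>f y\<bar>) \<partial>M)"
    if x: "x \<in> space N" for x and f :: "'m \<Rightarrow> real"
    using finite_k[OF x]
  proof (intro nn_integral_cong_AE, eventually_elim)
    case (elim y)
    then have "\<bar>k x y * ereal (f y)\<bar> = ereal (\<kappa> x y * \<bar>f y\<bar>)"
      by (cases "k x y") (auto simp: \<kappa>_def abs_mult)
    then show ?case by (simp add: ennreal.abs_eq)
  qed
  \<comment> \<open>Reduction to a nonnegative function of norm \<open>1\<close>: the integral
    against \<open>\<kappa>\<close> scales with the norm.\<close>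
  have normalized: "(\<lambda>y. \<bar>f y\<bar> / Lp_norm M p f) \<in> borel_measurable M \<and> (\<forall>y. 0 \<le> \<bar>f y\<bar> / Lp_norm M p f) \<and>
      (\<integral>\<^sup>+ y. ennreal ((\<bar>f y\<bar> / Lp_norm M p f) powr p) \<partial>M) = 1 \<and> 0 < Lp_norm M p f \<and>
      (\<forall>x\<in>space N. (\<integral>\<^sup>+ y. ennreal (\<kappa> x y * \<bar>f y\<bar>) \<partial>M)
        = ennreal (Lp_norm M p f) * (\<integral>\<^sup>+ y. ennreal (\<kappa> x y * (\<bar>f y\<bar> / Lp_norm M p f)) \<partial>M))"
    if f: "in_Lp M p f" and n0: "Lp_norm M p f \<noteq> 0" for f
  proof -
    have [measurable]: "f \<in> borel_measurable M" using f by (simp add: in_Lp_def)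
    define n where "n = Lp_norm M p f"
    define I where "I = (\<integral>y. \<bar>f y\<bar> powr p \<partial>M)"
    have n: "0 < n" using n0 by (simp add: n_def Lp_norm_def)
    have I0: "0 \<le> I" by (simp add: I_def)
    have np: "n powr p = I" using I0 p1 by (simp add: n_def Lp_norm_def I_def powr_powr)
    have "integrable M (\<lambda>y. \<bar>f y\<bar> powr p)"
      by (rule integrableI_nonneg) (use f in \<open>auto simp: in_Lp_def\<close>)
    then have I: "(\<integral>\<^sup>+ y. ennreal (\<bar>f y\<bar> powr p) \<partial>M) = ennreal I"
      unfolding I_def by (intro nn_integral_eq_integral) auto
    have Ipos: "0 < I" using n np by (metis powr_gt_zero less_irrefl)
    have "(\<integral>\<^sup>+ y. ennreal ((\<bar>f y\<bar> / n) powr p) \<partial>M) = (\<integral>\<^sup>+ y. ennreal (1 / I) * ennreal (\<bar>f y\<bar> powr p) \<partial>M)"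
      using Ipos by (intro nn_integral_cong) (simp add: powr_divide np flip: ennreal_mult)
    also have "\<dots> = ennreal (1 / I) * ennreal I" by (simp add: nn_integral_cmult I)
    also have "\<dots> = 1" using Ipos by (simp flip: ennreal_mult)
    finally have "(\<integral>\<^sup>+ y. ennreal ((\<bar>f y\<bar> / n) powr p) \<partial>M) = 1" .
    moreover have "(\<integral>\<^sup>+ y. ennreal (\<kappa> x y * \<bar>f y\<bar>) \<partial>M) = ennreal n * (\<integral>\<^sup>+ y. ennreal (\<kappa> x y * (\<bar>f y\<bar> / n)) \<partial>M)"
      if x: "x \<in> space N" for x
    proof -
      have [measurable]: "\<kappa> x \<in> borel_measurable M" using K.measurable_sections(1)[OF x] by simp
      show ?thesis
        using n \<kappa>0 by (subst nn_integral_cmult[symmetric]) (auto intro!: nn_integral_cong simp flip: ennreal_mult)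
    qed
    ultimately show ?thesis using n unfolding n_def[symmetric] by auto
  qed
  have "AE x in N. (\<integral>\<^sup>+ y. e2ennreal \<bar>k x y * ereal (f y)\<bar> \<partial>M) < \<infinity>" if f: "in_Lp M p f" for f
  proof (cases "Lp_norm M p f = 0")
    \<comment> \<open>Here \<open>f\<close> vanishes almost everywhere, and since
      \<open>\<infinity> * 0 = 0\<close> in \<open>ereal\<close> the integrand vanishes there even
      if the kernel is infinite.\<close>
    case True
    have [measurable]: "f \<in> borel_measurable M" using f by (simp add: in_Lp_def)
    have int: "integrable M (\<lambda>y. \<bar>f y\<bar> powr p)"
      by (rule integrableI_nonneg) (use f in \<open>auto simp: in_Lp_def\<close>)
    have "(\<integral>y. \<bar>f y\<bar> powr p \<partial>M) = 0" using True p1 by (simp add: Lp_norm_def)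
    then have "AE y in M. f y = 0" using int by (simp add: integral_nonneg_eq_0_iff_AE)
    then have "(\<integral>\<^sup>+ y. e2ennreal \<bar>k x y * ereal (f y)\<bar> \<partial>M) = (\<integral>\<^sup>+ y. 0 \<partial>M)" for x
      by (intro nn_integral_cong_AE, eventually_elim) (simp flip: zero_ereal_def zero_ennreal.abs_eq)
    then show ?thesis by simp
  next
    case False
    note F = normalized[OF f False]
    then have "AE x in N. (\<integral>\<^sup>+ y. ennreal (\<kappa> x y * (\<bar>f y\<bar> / Lp_norm M p f)) \<partial>M) < \<infinity>"
      using C1[of "\<lambda>y. \<bar>f y\<bar> / Lp_norm M p f"] by auto
    with AE_space show ?thesis
      by eventually_elim (use F in \<open>auto simp: abs_kf ennreal_mult_less_top\<close>)
  qed
  moreover have "(\<integral>\<^sup>+ x. ennreal (exp ((\<beta>0 / (A * \<beta>)) * (\<bar>intop M k f x\<bar> / Lp_norm M p f) powr \<beta>)) \<partial>N) \<le> ennreal C1"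
    if f: "in_Lp M p f" and n0: "Lp_norm M p f \<noteq> 0" for f
  proof -
    note F = normalized[OF f n0]
    define n where "n = Lp_norm M p f"
    have n: "0 < n" using F by (simp add: n_def)
    have "ennreal (\<bar>intop M k f x\<bar> / n) \<le> (\<integral>\<^sup>+ y. ennreal (\<kappa> x y * (\<bar>f y\<bar> / n)) \<partial>M)" if x: "x \<in> space N" for x
    proof -
      have "ennreal \<bar>intop M k f x\<bar> \<le> (\<integral>\<^sup>+ y. ennreal (\<kappa> x y * \<bar>f y\<bar>) \<partial>M)"
      \<comment> \<open>If the integrand is not integrable, \<open>intop\<close> takes the default
        value \<open>0\<close> and the bound is trivial.\<close>
      proof (cases "integrable M (\<lambda>y. real_of_ereal (k x y) * f y)")
        case True
        have "ennreal \<bar>intop M k f x\<bar> \<le> (\<integral>\<^sup>+ y. ennreal (norm (real_of_ereal (k x y) * f y)) \<partial>M)"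
          using integral_norm_bound_ennreal[OF True] by (simp add: intop_def)
        also have "\<dots> = (\<integral>\<^sup>+ y. ennreal (\<kappa> x y * \<bar>f y\<bar>) \<partial>M)"
        proof (intro nn_integral_cong arg_cong[of _ _ ennreal])
          fix y show "norm (real_of_ereal (k x y) * f y) = \<kappa> x y * \<bar>f y\<bar>"
            by (cases "k x y") (auto simp: \<kappa>_def abs_mult)
        qed
        finally show ?thesis .
      qed (simp add: intop_def not_integrable_integral_eq)
      then have "ennreal (1 / n) * ennreal \<bar>intop M k f x\<bar>
          \<le> ennreal (1 / n) * (ennreal n * (\<integral>\<^sup>+ y. ennreal (\<kappa> x y * (\<bar>f y\<bar> / n)) \<partial>M))"
        using F x unfolding n_def[symmetric] by (intro mult_left_mono) auto
      then show ?thesis using n by (simp flip: mult.assoc ennreal_mult)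
    qed
    then show ?thesis
      using C1[of "\<lambda>y. \<bar>f y\<bar> / n"] F n unfolding n_def[symmetric] by (auto simp: less_imp_le)
  qed
  ultimately show ?thesis unfolding p_def[symmetric] by blast
qed

end
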